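(* Let $(R_i,B_i,L_i)$, $i=1,2,\dots$, be a sequence of Hadamard triples on $\mathbb{R}^d$ such that the infinite convolution $$\mu=\delta_{\mathbf{R}_1^{-1}B_1}\ast\delta_{\mathbf{R}_2^{-1}B_2}\ast\cdots\ast\delta_{\mathbf{R}_n^{-1}B_n}\ast\cdots,\qquad \mathbf{R}_n=R_nR_{n-1}\cdots R_1,$$ converges weakly to a Borel probability measure $\mu$. Suppose that $\mu$ satisfies the no-overlap condition and that $\mu$ is compactly supported. If $\inf_n\min\sigma(\mathcal{F}_n)>0$, then $$\Lambda=\bigcup_{n\ge1}\Lambda_n,\qquad \Lambda_n=L_1+R_1^TL_2+\cdots+R_1^TR_2^T\cdots R_{n-1}^TL_n,$$ is a spectrum for $\mu$. In particular, if $\inf_n\inf_{\lambda\in\Lambda_n}|\widehat{\mu_{>n}}(\lambda)|>0$, then $\Lambda$ is a spectrum for $\mu$.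
   Context: Hadamard triple: $R\in M_d(\mathbb{Z})$ is expansive (all eigenvalues have modulus strictly greater than $1$), $B,L\subset\mathbb{Z}^d$ are finite with $0\in B\cap L$ and $\#B=\#L=N$, and the matrix $\frac{1}{\sqrt N}\left[e^{2\pi i\langle R^{-1}b,\ell\rangle}\right]_{\ell\in L,b\in B}$ is unitary. For a finite set $A\subset\mathbb{R}^d$, $\delta_A=\frac{1}{\#A}\sum_{a\in A}\delta_a$, where $\delta_a$ is the Dirac mass at $a$. The Fourier transform is $\widehat{\mu}(\xi)=\int e^{-2\pi i\langle\xi,x\rangle}\,d\mu(x)$. A countable set $\Lambda\subset\mathbb{R}^d$ is a spectrum for $\mu$ if $\{e^{2\pi i\langle\lambda,x\rangle}:\lambda\in\Lambda\}$ is an orthonormal basis of $L^2(\mu)$. Notation: $N_i=\#B_i=\#L_i$; $\mathbf{M}_n=\prod_{i=1}^nN_i$; $\mu_{>n}=\delta_{\mathbf{R}_{n+1}^{-1}B_{n+1}}\ast\delta_{\mathbf{R}_{n+2}^{-1}B_{n+2}}\ast\cdots$; $$K_n=\Big\{\sum_{k=n+1}^\infty\mathbf{R}_k^{-1}b_k:b_k\in B_k\Big\},\qquad \mathbf{B}_n=\Big\{\sum_{k=1}^n\mathbf{R}_k^{-1}b_k:b_k\in B_k\Big\}.$$ One has $\#\mathbf{B}_n=\#\Lambda_n=\mathbf{M}_n$; $K_0$ is the support of $\mu$ and $K_n$ is the support of $\mu_{>n}$. No-overlap condition: $\mu\big((\mathbf{b}+K_n)\cap(\mathbf{b}'+K_n)\big)=0$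 for all $\mathbf{b}\ne\mathbf{b}'$ in $\mathbf{B}_n$ and all $n\in\mathbb{N}$. $\mathcal{F}_n=\frac{1}{\sqrt{\mathbf{M}_n}}\left[|\widehat{\mu_{>n}}(\lambda)|\,e^{-2\pi i\langle\mathbf{b},\lambda\rangle}\right]_{\lambda\in\Lambda_n,\ \mathbf{b}\in\mathbf{B}_n}$, and $\sigma(\mathcal{F}_n)$ denotes the set of eigenvalues of $\mathcal{F}_n^*\mathcal{F}_n$ (called the singular values of $\mathcal{F}_n$ here). *)

theory Defs
  imports "HOL-Probability.Probability"
begin

section \<open>Matrices indexed by finite sets\<close>

text \<open>
  A matrix with rows indexed by \<open>I\<close> and columns indexed by \<open>J\<close> is a function \<open>A i j\<close> of which only
  the values at \<open>i \<in> I\<close>, \<open>j \<in> J\<close> are used. This is needed because the index sets below are finite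
  subsets of \<open>\<real>\<^sup>d\<close> whose sizes vary with \<open>n\<close>.
\<close>

definition unitary_matrix :: "'i set \<Rightarrow> 'j set \<Rightarrow> ('i \<Rightarrow> 'j \<Rightarrow> complex) \<Rightarrow> bool" where
  "unitary_matrix I J A \<longleftrightarrow>
     (\<forall>j\<in>J. \<forall>j'\<in>J. (\<Sum>i\<in>I. cnj (A i j) * A i j') = (if j = j' then 1 else 0)) \<and>
     (\<forall>i\<in>I. \<forall>i'\<in>I. (\<Sum>j\<in>J. A i j * cnj (A i' j)) = (if i = i' then 1 else 0))"

definition eigenvalues :: "'i set \<Rightarrow> ('i \<Rightarrow> 'i \<Rightarrow> complex) \<Rightarrow> complex set" where
  "eigenvalues I A =
     {z. \<exists>v. (\<exists>i\<in>I. v i \<noteq> 0) \<and> (\<forall>i\<in>I. (\<Sum>j\<in>I. A i j * v j) = z * v i)}"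

definition gram_matrix :: "'i set \<Rightarrow> ('i \<Rightarrow> 'j \<Rightarrow> complex) \<Rightarrow> 'j \<Rightarrow> 'j \<Rightarrow> complex" where
  "gram_matrix I A j j' = (\<Sum>i\<in>I. cnj (A i j) * A i j')"

text \<open>
  The eigenvalues of \<open>A\<^sup>* A\<close> itself, without square roots. This matrix is Hermitian, so all
  its eigenvalues are real and collecting the real ones loses nothing.
\<close>

definition singular_values :: "'i set \<Rightarrow> 'j set \<Rightarrow> ('i \<Rightarrow> 'j \<Rightarrow> complex) \<Rightarrow> real set" where
  "singular_values I J A = {s. complex_of_real s \<in> eigenvalues J (gram_matrix I A)}"


section \<open>Hadamard triples\<close>

definition int_lattice :: "(real ^ 'd) set" where
  "int_lattice = {x. \<forall>i. x $ i \<in> \<int>}"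

definition int_matrix :: "real ^ 'd ^ 'd \<Rightarrow> bool" where
  "int_matrix R \<longleftrightarrow> (\<forall>i j. R $ i $ j \<in> \<int>)"

definition expansive :: "real ^ 'd ^ 'd \<Rightarrow> bool" where
  "expansive R \<longleftrightarrow>
     (\<forall>z \<in> eigenvalues UNIV (\<lambda>i j. complex_of_real (R $ i $ j)). cmod z > 1)"

definition hadamard_triple ::
    "real ^ 'd ^ 'd \<Rightarrow> (real ^ 'd) set \<Rightarrow> (real ^ 'd) set \<Rightarrow> bool" where
  "hadamard_triple R B L \<longleftrightarrow>
     int_matrix R \<and> expansive R \<and>
     finite B \<and> finite L \<and> B \<subseteq> int_lattice \<and> L \<subseteq> int_lattice \<and>
     0 \<in> B \<inter> L \<and> card B = card L \<and>
     unitary_matrix L B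
       (\<lambda>l b. 1 / complex_of_real (sqrt (real (card B))) * cis (2 * pi * ((matrix_inv R *v b) \<bullet> l)))"


section \<open>Measures on Euclidean space\<close>

definition dirac_average :: "'a::topological_space set \<Rightarrow> 'a measure" where
  "dirac_average A = distr (uniform_count_measure A) borel (\<lambda>x. x)"

definition fourier :: "(real ^ 'd) measure \<Rightarrow> real ^ 'd \<Rightarrow> complex" where
  "fourier \<mu> \<xi> = (\<integral>x. cis (- 2 * pi * (\<xi> \<bullet> x)) \<partial>\<mu>)"

definition measure_support :: "'a::topological_space measure \<Rightarrow> 'a set" where
  "measure_support \<mu> = {x. \<forall>U. open U \<longrightarrow> x \<in> U \<longrightarrow> emeasure \<mu> U > 0}"

definition converges_weakly ::
    "(nat \<Rightarrow> 'a::topological_space measure) \<Rightarrow> 'a measure \<Rightarrow> bool" where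
  "converges_weakly M N \<longleftrightarrow>
     (\<forall>f :: 'a \<Rightarrow> real. continuous_on UNIV f \<longrightarrow> bounded (range f) \<longrightarrow>
        (\<lambda>n. \<integral>x. f x \<partial>M n) \<longlonglongrightarrow> (\<integral>x. f x \<partial>N))"

primrec finite_convolution ::
    "(nat \<Rightarrow> 'a::ordered_euclidean_space measure) \<Rightarrow> nat \<Rightarrow> 'a measure" where
  "finite_convolution \<nu> 0 = return borel 0"
| "finite_convolution \<nu> (Suc n) = (finite_convolution \<nu> n \<star> \<nu> n)"

definition is_infinite_convolution ::
    "(nat \<Rightarrow> 'a::ordered_euclidean_space measure) \<Rightarrow> 'a measure \<Rightarrow> bool" where
  "is_infinite_convolution \<nu> \<mu> \<longleftrightarrow>
     sets \<mu> = sets borel \<and> prob_space \<mu> \<and> converges_weakly (finite_convolution \<nu>) \<mu>"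

text \<open>Only meaningful if the finite convolutions converge weakly; the limit is then unique.\<close>

definition infinite_convolution ::
    "(nat \<Rightarrow> 'a::ordered_euclidean_space measure) \<Rightarrow> 'a measure" where
  "infinite_convolution \<nu> = (THE \<mu>. is_infinite_convolution \<nu> \<mu>)"


section \<open>Spectra\<close>

definition square_integrable :: "'a measure \<Rightarrow> ('a \<Rightarrow> complex) \<Rightarrow> bool" where
  "square_integrable \<mu> f \<longleftrightarrow>
     f \<in> borel_measurable \<mu> \<and> integrable \<mu> (\<lambda>x. (cmod (f x))\<^sup>2)"

definition L2_inner :: "'a measure \<Rightarrow> ('a \<Rightarrow> complex) \<Rightarrow> ('a \<Rightarrow> complex) \<Rightarrow> complex" where
  "L2_inner \<mu> f g = (\<integral>x. f x * cnj (g x) \<partial>\<mu>)"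

definition L2_norm :: "'a measure \<Rightarrow> ('a \<Rightarrow> complex) \<Rightarrow> real" where
  "L2_norm \<mu> f = sqrt (\<integral>x. (cmod (f x))\<^sup>2 \<partial>\<mu>)"

text \<open>
  An orthonormal family in \<open>L\<^sup>2(\<mu>)\<close> whose linear span is dense; elements of \<open>L\<^sup>2(\<mu>)\<close> are represented
  by square-integrable functions.
\<close>

definition orthonormal_basis :: "'a measure \<Rightarrow> 'i set \<Rightarrow> ('i \<Rightarrow> 'a \<Rightarrow> complex) \<Rightarrow> bool" where
  "orthonormal_basis \<mu> I e \<longleftrightarrow>
     (\<forall>i\<in>I. square_integrable \<mu> (e i)) \<and>
     (\<forall>i\<in>I. \<forall>j\<in>I. L2_inner \<mu> (e i) (e j) = (if i = j then 1 else 0)) \<and>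
     (\<forall>f. square_integrable \<mu> f \<longrightarrow>
        (\<forall>\<epsilon>>0. \<exists>F c. finite F \<and> F \<subseteq> I \<and> L2_norm \<mu> (\<lambda>x. f x - (\<Sum>i\<in>F. c i * e i x)) < \<epsilon>))"

definition is_spectrum :: "(real ^ 'd) set \<Rightarrow> (real ^ 'd) measure \<Rightarrow> bool" where
  "is_spectrum \<Lambda> \<mu> \<longleftrightarrow>
     countable \<Lambda> \<and> orthonormal_basis \<mu> \<Lambda> (\<lambda>\<xi> x. cis (2 * pi * (\<xi> \<bullet> x)))"


section \<open>Objects attached to a sequence of Hadamard triples\<close>

text \<open>
  Sequences \<open>R\<close>, \<open>B\<close>, \<open>L\<close> are indexed from 1; their values at 0 are never used.
  In \<open>finite_convolution \<nu>\<close> and \<open>infinite_convolution \<nu>\<close> the factors are \<open>\<nu> 0, \<nu> 1, \<dots>\<close>,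
  whence the shifts by \<open>Suc\<close>.
\<close>

primrec R_prod :: "(nat \<Rightarrow> real ^ 'd ^ 'd) \<Rightarrow> nat \<Rightarrow> real ^ 'd ^ 'd" where
  "R_prod R 0 = mat 1"
| "R_prod R (Suc n) = R (Suc n) ** R_prod R n"

definition factor ::
    "(nat \<Rightarrow> real ^ 'd ^ 'd) \<Rightarrow> (nat \<Rightarrow> (real ^ 'd) set) \<Rightarrow> nat \<Rightarrow> (real ^ 'd) measure" where
  "factor R B k = dirac_average ((\<lambda>b. matrix_inv (R_prod R k) *v b) ` B k)"

definition tail_measure ::
    "(nat \<Rightarrow> real ^ 'd ^ 'd) \<Rightarrow> (nat \<Rightarrow> (real ^ 'd) set) \<Rightarrow> nat \<Rightarrow> (real ^ 'd) measure" where
  "tail_measure R B n = infinite_convolution (\<lambda>k. factor R B (n + Suc k))"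

definition K_set ::
    "(nat \<Rightarrow> real ^ 'd ^ 'd) \<Rightarrow> (nat \<Rightarrow> (real ^ 'd) set) \<Rightarrow> nat \<Rightarrow> (real ^ 'd) set" where
  "K_set R B n =
     {x. \<exists>b. (\<forall>k>n. b k \<in> B k) \<and>
             (\<lambda>j. matrix_inv (R_prod R (n + Suc j)) *v b (n + Suc j)) sums x}"

definition B_set ::
    "(nat \<Rightarrow> real ^ 'd ^ 'd) \<Rightarrow> (nat \<Rightarrow> (real ^ 'd) set) \<Rightarrow> nat \<Rightarrow> (real ^ 'd) set" where
  "B_set R B n =
     {(\<Sum>k=1..n. matrix_inv (R_prod R k) *v b k) |b. \<forall>k\<in>{1..n}. b k \<in> B k}"

text \<open>Here \<open>R\<^sub>1\<^sup>T R\<^sub>2\<^sup>T \<dots> R\<^sub>k\<^sub>-\<^sub>1\<^sup>T\<close> is the transpose of \<open>R\<^sub>k\<^sub>-\<^sub>1 \<dots> R\<^sub>2 R\<^sub>1\<close>.\<close>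

definition Lambda_set ::
    "(nat \<Rightarrow> real ^ 'd ^ 'd) \<Rightarrow> (nat \<Rightarrow> (real ^ 'd) set) \<Rightarrow> nat \<Rightarrow> (real ^ 'd) set" where
  "Lambda_set R L n =
     {(\<Sum>k=1..n. transpose (R_prod R (k - 1)) *v l k) |l. \<forall>k\<in>{1..n}. l k \<in> L k}"

definition no_overlap ::
    "(nat \<Rightarrow> real ^ 'd ^ 'd) \<Rightarrow> (nat \<Rightarrow> (real ^ 'd) set) \<Rightarrow> (real ^ 'd) measure \<Rightarrow> bool" where
  "no_overlap R B \<mu> \<longleftrightarrow>
     (\<forall>n\<ge>1. \<forall>b\<in>B_set R B n. \<forall>b'\<in>B_set R B n. b \<noteq> b' \<longrightarrow>
        emeasure \<mu> ((\<lambda>x. b + x) ` K_set R B n \<inter> (\<lambda>x. b' + x) ` K_set R B n) = 0)"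

definition F_matrix ::
    "(nat \<Rightarrow> real ^ 'd ^ 'd) \<Rightarrow> (nat \<Rightarrow> (real ^ 'd) set) \<Rightarrow> nat \<Rightarrow>
     real ^ 'd \<Rightarrow> real ^ 'd \<Rightarrow> complex" where
  "F_matrix R B n \<xi> b =
     1 / complex_of_real (sqrt (real (\<Prod>i=1..n. card (B i)))) *
     (complex_of_real (cmod (fourier (tail_measure R B n) \<xi>)) * cis (- 2 * pi * (b \<bullet> \<xi>)))"

definition \<sigma>_F ::
    "(nat \<Rightarrow> real ^ 'd ^ 'd) \<Rightarrow> (nat \<Rightarrow> (real ^ 'd) set) \<Rightarrow> (nat \<Rightarrow> (real ^ 'd) set) \<Rightarrow> nat \<Rightarrow>
     real set" where
  "\<sigma>_F R B L n = singular_values (Lambda_set R L n) (B_set R B n) (F_matrix R B n)"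

end

theory Submission
  imports Defs
begin

text \<open>
  Compactness of the support bounds all partial sums \<open>\<Sum> \<^bold>R\<^sub>k\<^sup>-\<^sup>1 b\<^sub>k\<close>; since \<open>0 \<in> B\<^sub>k\<close>, sub-sums are partial sums too,
  so the series of maximal digits converges. Hence the tails \<open>\<mu>\<^sub>>\<^sub>n\<close> exist as laws of
  absolutely convergent random series, are supported in balls shrinking to 0, and \<open>\<mu>\<close> is the average of the translates of \<open>\<mu>\<^sub>>\<^sub>n\<close> by \<open>\<^bold>B\<^sub>n\<close>.
  Orthonormality of the exponentials is the unitarity of the product Hadamard matrices.

  For completeness, replace a continuous \<open>\<phi>\<close> by the step function with value \<open>\<phi>(b)\<close> on the translate of
  \<open>\<mu>\<^sub>>\<^sub>n\<close> by \<open>b\<close>. Its Fourier coefficients at \<open>\<Lambda>\<^sub>n\<close> are, up to phases and normalisation, the vector \<open>F\<^sub>n (\<phi>(b))\<^sub>b\<close>, so if all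
  eigenvalues of \<open>F\<^sub>n\<^sup>* F\<^sub>n\<close> are at least \<open>s\<close>, the Fourier sum over \<open>\<Lambda>\<^sub>n\<close> captures
  at least the fraction \<open>s\<close> of its squared norm. For large \<open>n\<close> the squared distance of \<open>\<phi>\<close> to the trigonometric polynomials
  is thus at most \<open>(1 - s\<^sup>2) \<parallel>\<phi>\<parallel>\<^sup>2\<close> plus an arbitrarily small error; applying this
  to the residual again and again makes it 0. The lower bound on \<open>|\<mu>\<^sub>>\<^sub>n^|\<close> is a special case because the Hadamard matrix
  itself is unitary.
\<close>

section \<open>Smallest singular values\<close>

text \<open>Two features of the statement shape the proof. \<open>Min\<close> and \<open>INF\<close>
  on the reals carry information only for finite nonempty sets and for families bounded below, so
  finiteness, existence and nonnegativity of the eigenvalues come before any use of the hypothesis;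
  minimising the Rayleigh quotient supplies both existence and the lower bound. And
  \<open>tail_measure\<close> is a definite description, so the tails have to be constructed before
  their Fourier transforms mean anything. The rate \<open>1 - s\<^sup>2\<close> is
  \<open>(1 + s) * (1 - s)\<close>: projecting the step function leaves at most the fraction
  \<open>1 - s\<close>, and passing from \<phi> to its step function costs the factor
  \<open>1 + s\<close>, by Young's inequality with weight s. Any weight t with (1 + t)(1 - s) < 1
  would contract as well. The contraction can be repeated because its residual is again bounded and
  continuous; the step function appears only inside a single round.\<close>

lemma complex_of_real_sum_cmod_sq:
  "complex_of_real (\<Sum>j\<in>J. (cmod (v j))\<^sup>2) = (\<Sum>j\<in>J. cnj (v j) * v j)"
  by (simp only: of_real_sum complex_norm_square mult.commute)

text \<open>The Gram matrix pairs w with v as A pairs A w with A v. Nonnegativity of eigenvalues,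
  orthogonality of eigenvectors and the Rayleigh quotient are all read off from this form.\<close>

lemma gram_matrix_sesquilinear:
  "(\<Sum>j\<in>J. cnj (w j) * (\<Sum>j'\<in>J. gram_matrix I A j j' * v j')) =
   (\<Sum>i\<in>I. cnj (\<Sum>j\<in>J. A i j * w j) * (\<Sum>j\<in>J. A i j * v j))"
proof -
  have "(\<Sum>j\<in>J. cnj (w j) * (\<Sum>j'\<in>J. gram_matrix I A j j' * v j')) =
    (\<Sum>j\<in>J. \<Sum>j'\<in>J. \<Sum>i\<in>I. cnj (A i j * w j) * (A i j' * v j'))"
    unfolding gram_matrix_def
    by (simp add: sum_distrib_left sum_distrib_right mult_ac)
  also have "\<dots> = (\<Sum>j\<in>J. \<Sum>i\<in>I. \<Sum>j'\<in>J. cnj (A i j * w j) * (A i j' * v j'))"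
    by (intro sum.cong refl sum.swap)
  also have "\<dots> = (\<Sum>i\<in>I. \<Sum>j\<in>J. \<Sum>j'\<in>J. cnj (A i j * w j) * (A i j' * v j'))"
    by (rule sum.swap)
  also have "\<dots> = (\<Sum>i\<in>I. cnj (\<Sum>j\<in>J. A i j * w j) * (\<Sum>j\<in>J. A i j * v j))"
    by (simp add: sum_product)
  finally show ?thesis .
qed

lemma singular_values_iff:
  "s \<in> singular_values I J A \<longleftrightarrow>
    (\<exists>v. (\<exists>j\<in>J. v j \<noteq> 0) \<and> (\<forall>j\<in>J. (\<Sum>j'\<in>J. gram_matrix I A j j' * v j') = complex_of_real s * v j))"
  unfolding singular_values_def eigenvalues_def by simp

lemma sum_cmod_sq_pos:
  assumes "finite J" "\<exists>j\<in>J. v j \<noteq> 0"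
  shows "0 < (\<Sum>j\<in>J. (cmod (v j))\<^sup>2)"
proof -
  obtain j where "j \<in> J" "v j \<noteq> 0" using assms by blast
  then show ?thesis using assms(1) by (intro sum_pos2[of J j]) auto
qed

lemma singular_value_nonneg:
  assumes "finite J" "s \<in> singular_values I J A"
  shows "0 \<le> s"
proof -
  obtain v where v: "\<exists>j\<in>J. v j \<noteq> 0"
    and ev: "\<And>j. j \<in> J \<Longrightarrow> (\<Sum>j'\<in>J. gram_matrix I A j j' * v j') = complex_of_real s * v j"
    using assms(2) unfolding singular_values_iff by blast
  have "complex_of_real (s * (\<Sum>j\<in>J. (cmod (v j))\<^sup>2)) =
      (\<Sum>j\<in>J. cnj (v j) * (complex_of_real s * v j))"
    unfolding of_real_mult complex_of_real_sum_cmod_sq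
    by (simp add: sum_distrib_left mult_ac)
  also have "\<dots> = (\<Sum>j\<in>J. cnj (v j) * (\<Sum>j'\<in>J. gram_matrix I A j j' * v j'))"
    by (intro sum.cong refl) (simp add: ev)
  also have "\<dots> = complex_of_real (\<Sum>i\<in>I. (cmod (\<Sum>j\<in>J. A i j * v j))\<^sup>2)"
    unfolding gram_matrix_sesquilinear complex_of_real_sum_cmod_sq ..
  finally have "s * (\<Sum>j\<in>J. (cmod (v j))\<^sup>2) = (\<Sum>i\<in>I. (cmod (\<Sum>j\<in>J. A i j * v j))\<^sup>2)"
    unfolding of_real_eq_iff .
  also have "\<dots> \<ge> 0" by (intro sum_nonneg) auto
  finally show ?thesis
    using sum_cmod_sq_pos[OF assms(1) v] by (simp add: zero_le_mult_iff)
qed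

text \<open>Bessel's inequality for the unit vectors \<open>e\<^sub>j\<close>, summed over \<open>j\<close>.\<close>
lemma card_orthonormal_le:
  assumes "finite J" "finite E"
    and on: "\<And>s t. s \<in> E \<Longrightarrow> t \<in> E \<Longrightarrow>
      (\<Sum>j\<in>J. cnj (V s j) * V t j) = (if s = t then 1 else (0::complex))"
  shows "card E \<le> card J"
proof -
  have bessel: "(\<Sum>s\<in>E. (cmod (V s k))\<^sup>2) \<le> 1" if k: "k \<in> J" for k
  proof -
    \<comment> \<open>u is the projection of the unit vector e_k onto the span of the
      \<open>V s\<close>. Its k-th coordinate and its squared norm are both t, so the squared
      distance from e_k to u is \<open>1 - t\<close>.\<close>
    define u where "u j = (\<Sum>s\<in>E. cnj (V s k) * V s j)" for j
    define t where "t = (\<Sum>s\<in>E. (cmod (V s k))\<^sup>2)"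
    have uk: "u k = complex_of_real t"
      unfolding u_def t_def complex_of_real_sum_cmod_sq ..
    have "(\<Sum>j\<in>J. cnj (u j) * u j) =
        (\<Sum>j\<in>J. \<Sum>s\<in>E. \<Sum>s'\<in>E. V s k * cnj (V s' k) * (cnj (V s j) * V s' j))"
      unfolding u_def cnj_sum sum_product by (intro sum.cong refl) (simp add: mult_ac)
    also have "\<dots> = (\<Sum>s\<in>E. \<Sum>s'\<in>E. \<Sum>j\<in>J. V s k * cnj (V s' k) * (cnj (V s j) * V s' j))"
      by (subst sum.swap, rule sum.cong[OF refl], rule sum.swap)
    also have "\<dots> = (\<Sum>s\<in>E. \<Sum>s'\<in>E. V s k * cnj (V s' k) * (if s = s' then 1 else 0))"
      by (intro sum.cong refl) (simp add: sum_distrib_left[symmetric] on)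
    also have "\<dots> = (\<Sum>s\<in>E. V s k * cnj (V s k))"
      using assms(2) by (simp add: if_distrib cong: if_cong)
    also have "\<dots> = complex_of_real t"
      unfolding t_def complex_of_real_sum_cmod_sq by (simp add: mult.commute)
    finally have uu: "(\<Sum>j\<in>J. cnj (u j) * u j) = complex_of_real t" .
    define d where "d j = (if j = k then 1 else (0::complex))" for j
    have "complex_of_real (\<Sum>j\<in>J. (cmod (d j - u j))\<^sup>2) =
        (\<Sum>j\<in>J. cnj (d j) * d j - cnj (d j) * u j - d j * cnj (u j) + cnj (u j) * u j)"
      unfolding complex_of_real_sum_cmod_sq by (simp add: algebra_simps)
    also have "\<dots> = 1 - u k - cnj (u k) + (\<Sum>j\<in>J. cnj (u j) * u j)"
      unfolding sum.distrib sum_subtractf d_def using assms(1) k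
      by (simp add: if_distrib[of cnj] if_distrib[of "\<lambda>x. x * _"] cong: if_cong)
    also have "\<dots> = complex_of_real (1 - t)"
      unfolding uk uu by simp
    finally have "(\<Sum>j\<in>J. (cmod (d j - u j))\<^sup>2) = 1 - t"
      unfolding of_real_eq_iff .
    moreover have "0 \<le> (\<Sum>j\<in>J. (cmod (d j - u j))\<^sup>2)" by (intro sum_nonneg) auto
    ultimately show ?thesis unfolding t_def by linarith
  qed
  have one: "(\<Sum>j\<in>J. (cmod (V s j))\<^sup>2) = 1" if "s \<in> E" for s
  proof -
    have "complex_of_real (\<Sum>j\<in>J. (cmod (V s j))\<^sup>2) = complex_of_real 1"
      unfolding complex_of_real_sum_cmod_sq using on[OF that that] by simp
    then show ?thesis unfolding of_real_eq_iff .
  qed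
  have "real (card E) = (\<Sum>s\<in>E. \<Sum>j\<in>J. (cmod (V s j))\<^sup>2)"
    by (simp add: one)
  also have "\<dots> = (\<Sum>j\<in>J. \<Sum>s\<in>E. (cmod (V s j))\<^sup>2)" by (rule sum.swap)
  also have "\<dots> \<le> (\<Sum>j\<in>J. 1)" by (intro sum_mono bessel)
  finally show ?thesis by simp
qed

text \<open>Eigenvectors for distinct eigenvalues are orthogonal, so there are at most
  \<open>card J\<close> of them. On an infinite set \<open>Min\<close> would be unspecified.\<close>

lemma finite_singular_values:
  assumes J: "finite J"
  shows "finite (singular_values I J A)"
proof -
  have "card E \<le> card J" if E: "E \<subseteq> singular_values I J A" "finite E" for E
  proof -
    have "\<exists>v. (\<exists>j\<in>J. v j \<noteq> 0) \<and>
        (\<forall>j\<in>J. (\<Sum>j'\<in>J. gram_matrix I A j j' * v j') = complex_of_real s * v j)" if "s \<in> E" for s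
      using that E unfolding singular_values_iff[symmetric] by blast
    then obtain W where W0: "\<And>s. s \<in> E \<Longrightarrow> \<exists>j\<in>J. W s j \<noteq> 0"
      and ev: "\<And>s j. s \<in> E \<Longrightarrow> j \<in> J \<Longrightarrow>
        (\<Sum>j'\<in>J. gram_matrix I A j j' * W s j') = complex_of_real s * W s j"
      by metis
    have orth: "(\<Sum>j\<in>J. cnj (W s j) * W t j) = 0" if "s \<in> E" "t \<in> E" "s \<noteq> t" for s t
    proof -
      have 1: "complex_of_real t * (\<Sum>j\<in>J. cnj (W s j) * W t j) =
          (\<Sum>i\<in>I. cnj (\<Sum>j\<in>J. A i j * W s j) * (\<Sum>j\<in>J. A i j * W t j))" if "s \<in> E" "t \<in> E" for s t
      proof -
        have "complex_of_real t * (\<Sum>j\<in>J. cnj (W s j) * W t j) =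
            (\<Sum>j\<in>J. cnj (W s j) * (complex_of_real t * W t j))"
          by (simp add: sum_distrib_left mult_ac)
        also have "\<dots> = (\<Sum>j\<in>J. cnj (W s j) * (\<Sum>j'\<in>J. gram_matrix I A j j' * W t j'))"
          using that by (intro sum.cong refl) (simp add: ev)
        finally show ?thesis unfolding gram_matrix_sesquilinear .
      qed
      \<comment> \<open>Swapping s and t conjugates the pairing of the two image vectors, so
        multiplying one and the same inner product by t or by s gives the same value.\<close>
      have "complex_of_real t * (\<Sum>j\<in>J. cnj (W s j) * W t j) =
          cnj (complex_of_real s * (\<Sum>j\<in>J. cnj (W t j) * W s j))"
        unfolding 1[OF that(1,2)] 1[OF that(2,1)] by (simp add: mult_ac)
      also have "\<dots> = complex_of_real s * (\<Sum>j\<in>J. cnj (W s j) * W t j)"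
        by (simp add: mult_ac)
      finally show ?thesis using that(3) by auto
    qed
    define r where "r s = sqrt (\<Sum>j\<in>J. (cmod (W s j))\<^sup>2)" for s
    have r: "r s > 0" if "s \<in> E" for s
      unfolding r_def using sum_cmod_sq_pos[OF J W0[OF that]] by simp
    have r2: "(\<Sum>j\<in>J. cnj (W s j) * W s j) = complex_of_real (r s) * complex_of_real (r s)" for s
    proof -
      have "r s * r s = (\<Sum>j\<in>J. (cmod (W s j))\<^sup>2)"
        unfolding r_def by (simp add: sum_nonneg)
      then show ?thesis
        unfolding complex_of_real_sum_cmod_sq[symmetric] of_real_mult[symmetric] by simp
    qed
    show ?thesis
    proof (rule card_orthonormal_le[OF J E(2)])
      fix s t assume st: "s \<in> E" "t \<in> E"
      have "(\<Sum>j\<in>J. cnj (W s j / complex_of_real (r s)) * (W t j / complex_of_real (r t))) =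
          (\<Sum>j\<in>J. cnj (W s j) * W t j) / (complex_of_real (r s) * complex_of_real (r t))"
        by (simp add: sum_divide_distrib)
      then show "(\<Sum>j\<in>J. cnj (W s j / complex_of_real (r s)) * (W t j / complex_of_real (r t))) =
          (if s = t then 1 else 0)"
        using orth[OF st] r[OF st(1)] r2 by auto
    qed
  qed
  then show ?thesis using finite_if_finite_subsets_card_bdd by blast
qed

text \<open>The quotient attains its minimum on a compact unit sphere; homogeneity extends the bound
  to every w, and for w vanishing on J it is trivial.\<close>

lemma exists_rayleigh_minimizer:
  fixes A :: "'i \<Rightarrow> 'j \<Rightarrow> complex"
  assumes J: "finite J" "J \<noteq> {}"
  obtains v where "(\<Sum>j\<in>J. (cmod (v j))\<^sup>2) = 1"
    and "\<And>w. (\<Sum>i\<in>I. (cmod (\<Sum>j\<in>J. A i j * v j))\<^sup>2) * (\<Sum>j\<in>J. (cmod (w j))\<^sup>2)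
        \<le> (\<Sum>i\<in>I. (cmod (\<Sum>j\<in>J. A i j * w j))\<^sup>2)"
proof -
  define Q where "Q v = (\<Sum>i\<in>I. (cmod (\<Sum>j\<in>J. A i j * v j))\<^sup>2)" for v
  define N where "N v = (\<Sum>j\<in>J. (cmod (v j))\<^sup>2)" for v :: "'j \<Rightarrow> complex"
  \<comment> \<open>Vectors are functions on the whole index type, so the set \<open>N v = 1\<close>
    need not be compact. Cutting to 0 off J places it in a product of discs and points, compact by
    Tychonoff, and neither Q nor N notices the cut.\<close>
  define C where "C = PiE UNIV (\<lambda>j. if j \<in> J then cball 0 1 else {0::complex})"
  define S where "S = C \<inter> {v. N v = 1}"
  have contN: "continuous_on UNIV N"
    unfolding N_def by (intro continuous_intros continuous_on_product_coordinates)
  have contQ: "continuous_on UNIV Q"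
    unfolding Q_def by (intro continuous_intros continuous_on_product_coordinates)
  have "compactin (product_topology (\<lambda>_. euclidean) UNIV) C"
    unfolding C_def compactin_PiE by auto
  then have "compact C"
    unfolding euclidean_product_topology by simp
  moreover have "closed {v. N v = 1}"
    using contN by (intro closed_Collect_eq) auto
  ultimately have "compact S" unfolding S_def by (rule compact_Int_closed)
  have in_C: "(\<lambda>j. if j \<in> J then v j else 0) \<in> C" if "N v = 1" for v
  proof -
    have "cmod (v j) \<le> 1" if "j \<in> J" for j
    proof -
      have "(cmod (v j))\<^sup>2 \<le> N v" unfolding N_def using J that by (intro member_le_sum) auto
      then show ?thesis using \<open>N v = 1\<close> by (simp add: power_le_one_iff abs_square_le_1)
    qed
    then show ?thesis unfolding C_def by auto
  qed
  have cut: "Q (\<lambda>j. if j \<in> J then v j else 0) = Q v" "N (\<lambda>j. if j \<in> J then v j else 0) = N v" for v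
    unfolding Q_def N_def by (auto intro!: sum.cong arg_cong[of _ _ cmod])
  have inS: "(\<lambda>j. if j \<in> J then v j else 0) \<in> S" if "N v = 1" for v
    using in_C[OF that] cut(2)[of v] that unfolding S_def by simp
  obtain k where k: "k \<in> J" using J by blast
  have "N (\<lambda>j. if j = k then 1 else 0) = 1"
    unfolding N_def using J k by (simp add: if_distrib[of cmod] if_distrib[of "\<lambda>x. x\<^sup>2"] cong: if_cong)
  then have "S \<noteq> {}" using inS by blast
  then obtain v where v: "v \<in> S" and vmin: "\<And>w. w \<in> S \<Longrightarrow> Q v \<le> Q w"
    using continuous_attains_inf[OF \<open>compact S\<close>] continuous_on_subset[OF contQ] by (metis subset_UNIV)
  show ?thesis
  proof
    show "(\<Sum>j\<in>J. (cmod (v j))\<^sup>2) = 1" using v unfolding S_def N_def by simp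
    fix w
    have "Q v * N w \<le> Q w"
    proof (cases "N w = 0")
      case True
      then show ?thesis unfolding Q_def by (simp add: sum_nonneg)
    next
      case False
      then have pos: "N w > 0" unfolding N_def by (metis less_eq_real_def sum_nonneg zero_le_power2)
      define r where "r = sqrt (N w)"
      have r: "r > 0" "r\<^sup>2 = N w" unfolding r_def using pos by auto
      define u where "u j = w j / complex_of_real r" for j
      have "N u = 1"
        using r pos unfolding u_def N_def
        by (simp add: norm_divide power_divide sum_divide_distrib[symmetric])
      then have "Q v \<le> Q u" using vmin[OF inS] cut by metis
      also have "Q u = Q w / N w"
        using r unfolding u_def Q_def
        by (simp add: norm_divide power_divide sum_divide_distrib[symmetric])
      finally show ?thesis using pos by (simp add: field_simps)
    qed
    then show "(\<Sum>i\<in>I. (cmod (\<Sum>j\<in>J. A i j * v j))\<^sup>2) * (\<Sum>j\<in>J. (cmod (w j))\<^sup>2)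
        \<le> (\<Sum>i\<in>I. (cmod (\<Sum>j\<in>J. A i j * w j))\<^sup>2)"
      unfolding Q_def N_def .
  qed
qed

text \<open>First variation: moving v against the residual u of the eigenvalue equation changes Q -
  m N by -2 t N u up to order t^2. Minimality allows no decrease, so u vanishes on J and v is an
  eigenvector.\<close>

lemma rayleigh_minimum_singular_value:
  fixes A :: "'i \<Rightarrow> 'j \<Rightarrow> complex"
  assumes J: "finite J"
    and v: "(\<Sum>j\<in>J. (cmod (v j))\<^sup>2) = 1"
    and min: "\<And>w. (\<Sum>i\<in>I. (cmod (\<Sum>j\<in>J. A i j * v j))\<^sup>2) * (\<Sum>j\<in>J. (cmod (w j))\<^sup>2)
        \<le> (\<Sum>i\<in>I. (cmod (\<Sum>j\<in>J. A i j * w j))\<^sup>2)"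
  shows "(\<Sum>i\<in>I. (cmod (\<Sum>j\<in>J. A i j * v j))\<^sup>2) \<in> singular_values I J A"
proof -
  define Q where "Q v = (\<Sum>i\<in>I. (cmod (\<Sum>j\<in>J. A i j * v j))\<^sup>2)" for v
  define N where "N v = (\<Sum>j\<in>J. (cmod (v j))\<^sup>2)" for v :: "'j \<Rightarrow> complex"
  define m where "m = Q v"
  define G where "G v j = (\<Sum>j'\<in>J. gram_matrix I A j j' * v j')" for v j
  define u where "u j = G v j - complex_of_real m * v j" for j
  have expand: "Q (\<lambda>j. v j - complex_of_real t * u j) - m * N (\<lambda>j. v j - complex_of_real t * u j) =
      - 2 * t * N u + t\<^sup>2 * (Q u - m * N u)" for t
  proof -
    let ?t = "complex_of_real t"
    let ?I = "\<lambda>x y. \<Sum>j\<in>J. cnj (x j) * (y j :: complex)"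
    have Qc: "complex_of_real (Q x) = ?I x (G x)" for x
      unfolding Q_def complex_of_real_sum_cmod_sq G_def gram_matrix_sesquilinear ..
    have Nc: "complex_of_real (N x) = ?I x x" for x
      unfolding N_def complex_of_real_sum_cmod_sq ..
    have herm: "?I x (G y) = cnj (?I y (G x))" for x y
      unfolding G_def gram_matrix_sesquilinear by (simp add: mult_ac)
    have lin: "G (\<lambda>j. v j - ?t * u j) = (\<lambda>j. G v j - ?t * G u j)"
      unfolding G_def by (auto simp: algebra_simps sum_subtractf sum_distrib_left)
    have "?I u (G v) - complex_of_real m * ?I u v = (\<Sum>j\<in>J. cnj (u j) * (G v j - complex_of_real m * v j))"
      by (simp add: right_diff_distrib sum_subtractf sum_distrib_left mult_ac)
    then have uN: "?I u (G v) - complex_of_real m * ?I u v = complex_of_real (N u)"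
      unfolding Nc u_def[symmetric] .
    have "cnj (?I u (G v) - complex_of_real m * ?I u v) = complex_of_real (N u)"
      unfolding uN by simp
    then have uN': "?I v (G u) - complex_of_real m * ?I v u = complex_of_real (N u)"
      using herm[of v u] by (simp add: mult.commute)
    have m0: "?I v (G v) = complex_of_real m * ?I v v"
      using v unfolding Qc[symmetric] Nc[symmetric] m_def N_def by simp
    have "complex_of_real (Q (\<lambda>j. v j - ?t * u j) - m * N (\<lambda>j. v j - ?t * u j)) =
       (?I v (G v) - ?t * ?I u (G v) - ?t * ?I v (G u) + ?t * ?t * ?I u (G u)) -
       complex_of_real m * (?I v v - ?t * ?I u v - ?t * ?I v u + ?t * ?t * ?I u u)"
      unfolding of_real_diff of_real_mult Qc Nc lin
      by (simp add: algebra_simps sum_subtractf sum_distrib_left sum.distrib)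
    also have "\<dots> = (?I v (G v) - complex_of_real m * ?I v v)
       - ?t * (?I u (G v) - complex_of_real m * ?I u v)
       - ?t * (?I v (G u) - complex_of_real m * ?I v u)
       + ?t * ?t * (?I u (G u) - complex_of_real m * ?I u u)"
      by (simp add: algebra_simps)
    also have "\<dots> = complex_of_real (- 2 * t * N u + t\<^sup>2 * (Q u - m * N u))"
      unfolding uN uN' m0 unfolding Qc[symmetric] Nc[symmetric]
      by (simp add: power2_eq_square)
    finally show ?thesis unfolding of_real_eq_iff .
  qed
  define D where "D = Q u - m * N u"
  have D0: "D \<ge> 0" using min[of u] unfolding D_def Q_def m_def N_def by simp
  have ineq: "2 * t * N u \<le> t\<^sup>2 * D" for t
    using min[of "\<lambda>j. v j - complex_of_real t * u j"] expand[of t]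
    unfolding D_def Q_def m_def N_def by simp
  have Nu0: "N u \<ge> 0" unfolding N_def by (intro sum_nonneg) auto
  have "N u \<le> 0"
  proof (rule ccontr)
    assume "\<not> N u \<le> 0"
    then have pos: "N u > 0" by simp
    \<comment> \<open>The step length has to satisfy t D < 2 N u; the summand 1 covers D =
      0.\<close>
    define t where "t = N u / (D + 1)"
    have t: "t > 0" "t * (D + 1) = N u" unfolding t_def using pos D0 by auto
    have "2 * t * N u \<le> t * (t * D)" using ineq[of t] by (simp add: power2_eq_square)
    then have "2 * N u \<le> t * D" using t(1) by (metis mult.assoc mult.commute mult_le_cancel_left_pos)
    then show False using t pos by (simp add: algebra_simps)
  qed
  then have "N u = 0" using Nu0 by simp
  then have u0: "u j = 0" if "j \<in> J" for j
    using that J unfolding N_def by (simp add: sum_nonneg_eq_0_iff)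
  have "\<exists>j\<in>J. v j \<noteq> 0"
  proof (rule ccontr)
    assume "\<not> (\<exists>j\<in>J. v j \<noteq> 0)"
    then show False using v by simp
  qed
  then have "m \<in> singular_values I J A"
    unfolding singular_values_iff using u0 unfolding u_def G_def by (intro exI[of _ v]) auto
  then show ?thesis unfolding m_def Q_def .
qed

text \<open>Makes the minima bounded below in n, without which their infimum would say nothing. The
  minimizer shows that there is an eigenvalue at all.\<close>

lemma Min_singular_values_nonneg:
  assumes "finite J" "J \<noteq> {}"
  shows "0 \<le> Min (singular_values I J A)"
proof -
  obtain v where "(\<Sum>j\<in>J. (cmod (v j))\<^sup>2) = 1"
    and "\<And>w. (\<Sum>i\<in>I. (cmod (\<Sum>j\<in>J. A i j * v j))\<^sup>2) * (\<Sum>j\<in>J. (cmod (w j))\<^sup>2)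
        \<le> (\<Sum>i\<in>I. (cmod (\<Sum>j\<in>J. A i j * w j))\<^sup>2)"
    using exists_rayleigh_minimizer[OF assms] by blast
  from rayleigh_minimum_singular_value[OF assms(1) this] have "singular_values I J A \<noteq> {}" by blast
  then show ?thesis
    using finite_singular_values[OF assms(1)] singular_value_nonneg[OF assms(1)] by (meson Min_in)
qed

text \<open>The Rayleigh minimum is itself an eigenvalue, hence at least the smallest one. For empty
  J the unspecified \<open>Min {}\<close> is multiplied by an empty sum.\<close>

lemma Min_singular_values_le:
  assumes "finite J"
  shows "Min (singular_values I J A) * (\<Sum>j\<in>J. (cmod (w j))\<^sup>2) \<le>
    (\<Sum>i\<in>I. (cmod (\<Sum>j\<in>J. A i j * w j))\<^sup>2)"
proof (cases "J = {}")
  case False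
  obtain v where v: "(\<Sum>j\<in>J. (cmod (v j))\<^sup>2) = 1"
    and min: "\<And>w. (\<Sum>i\<in>I. (cmod (\<Sum>j\<in>J. A i j * v j))\<^sup>2) * (\<Sum>j\<in>J. (cmod (w j))\<^sup>2)
        \<le> (\<Sum>i\<in>I. (cmod (\<Sum>j\<in>J. A i j * w j))\<^sup>2)"
    using exists_rayleigh_minimizer[OF assms False] by blast
  have "Min (singular_values I J A) \<le> (\<Sum>i\<in>I. (cmod (\<Sum>j\<in>J. A i j * v j))\<^sup>2)"
    using finite_singular_values[OF assms] rayleigh_minimum_singular_value[OF assms v min] by (rule Min_le)
  then have "Min (singular_values I J A) * (\<Sum>j\<in>J. (cmod (w j))\<^sup>2) \<le>
      (\<Sum>i\<in>I. (cmod (\<Sum>j\<in>J. A i j * v j))\<^sup>2) * (\<Sum>j\<in>J. (cmod (w j))\<^sup>2)"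
    by (intro mult_right_mono sum_nonneg) auto
  then show ?thesis using min[of w] by linarith
qed (simp add: sum_nonneg)

section \<open>Weak limits and density of continuous functions\<close>

lemma (in finite_measure) integrable_bounded:
  fixes f :: "'a \<Rightarrow> 'b::{banach, second_countable_topology}"
  assumes "f \<in> borel_measurable M" "bounded (range f)"
  shows "integrable M f"
proof -
  obtain K where "\<And>x. norm (f x) \<le> K" using assms(2) unfolding bounded_iff by auto
  then show ?thesis using assms(1) by (intro integrable_const_bound[where B=K]) auto
qed

lemma continuous_borel_measurable:
  assumes "continuous_on UNIV f" "sets M = sets borel"
  shows "f \<in> borel_measurable M"
  using borel_measurable_continuous_onI[OF assms(1)] measurable_cong_sets[OF assms(2) refl] by blast

lemma integrable_bounded_continuous:
  fixes f :: "'a::topological_space \<Rightarrow> 'b::{banach, second_countable_topology}"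
  assumes "finite_measure M" "sets M = sets borel" "continuous_on UNIV f" "bounded (range f)"
  shows "integrable M f"
  using assms by (intro finite_measure.integrable_bounded continuous_borel_measurable)

text \<open>Closed sets form an intersection-stable generator of the Borel sets, and their
  indicators are pointwise limits of continuous functions with values in [0, 1]. Uniqueness of weak
  limits rests on this, as does the identification of the partial convolutions with uniform
  measures.\<close>

lemma measure_eqI_bounded_continuous:
  fixes M N :: "'a::metric_space measure"
  assumes M: "finite_measure M" "sets M = sets borel" and N: "finite_measure N" "sets N = sets borel"
    and eq: "\<And>f :: 'a \<Rightarrow> real. continuous_on UNIV f \<Longrightarrow> bounded (range f) \<Longrightarrow>
      (\<integral>x. f x \<partial>M) = (\<integral>x. f x \<partial>N)"
  shows "M = N"
proof (rule measure_eqI_generator_eq[where \<Omega> = UNIV and E = "Collect closed" and A = "\<lambda>_. UNIV"])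
  interpret M: finite_measure M by fact
  interpret N: finite_measure N by fact
  show "Int_stable (Collect closed :: 'a set set)" by (auto simp: Int_stable_def)
  show "sets M = sigma_sets UNIV (Collect closed)" "sets N = sigma_sets UNIV (Collect closed)"
    using M(2) N(2) unfolding borel_eq_closed by auto
  show "emeasure M UNIV \<noteq> \<infinity>" by (simp add: M.emeasure_eq_measure)
  fix F :: "'a set" assume "F \<in> Collect closed"
  then have F: "closed F" by simp
  show "emeasure M F = emeasure N F"
  \<comment> \<open>By convention \<open>infdist x {} = 0\<close>, so for empty F the functions
    \<open>f k\<close> would be constantly 1 instead of tending to the indicator.\<close>
  proof (cases "F = {}")
    case False
    define f where "f k x = max 0 (1 - real k * infdist x F)" for k x
    have cont: "continuous_on UNIV (f k)" for k
      unfolding f_def by (intro continuous_intros continuous_on_infdist)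
    have bd: "\<bar>f k x\<bar> \<le> 1" for k x
      unfolding f_def using infdist_nonneg[of x F] by auto
    have lim: "(\<lambda>k. f k x) \<longlonglongrightarrow> indicator F x" for x
    proof (cases "x \<in> F")
      case True
      then show ?thesis unfolding f_def using False by simp
    next
      case x: False
      then have pos: "infdist x F > 0"
        using F False infdist_pos_not_in_closed by blast
      obtain K :: nat where K: "1 < real K * infdist x F"
        using reals_Archimedean3[OF pos] by blast
      have "f k x = 0" if "k \<ge> K" for k
      proof -
        have "real K * infdist x F \<le> real k * infdist x F"
          using that pos by (intro mult_right_mono) auto
        then show ?thesis unfolding f_def using K by auto
      qed
      then have "eventually (\<lambda>k. f k x = 0) sequentially"
        unfolding eventually_sequentially by blast
      then show ?thesis using x by (simp add: tendsto_eventually)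
    qed
    have conv: "(\<lambda>k. \<integral>x. f k x \<partial>L) \<longlonglongrightarrow> measure L F"
      if "finite_measure L" "sets L = sets borel" for L :: "'a measure"
    proof -
      interpret L: finite_measure L by fact
      have "(\<lambda>k. \<integral>x. f k x \<partial>L) \<longlonglongrightarrow> (\<integral>x. indicator F x \<partial>L)"
      proof (rule integral_dominated_convergence[where w = "\<lambda>_. 1"])
        show "f k \<in> borel_measurable L" for k by (rule continuous_borel_measurable[OF cont that(2)])
        show "indicator F \<in> borel_measurable L" using borel_closed[OF F] that(2) by simp
      qed (use lim bd in simp_all)
      then show ?thesis using F that by (simp add: sets_eq_imp_space_eq[OF that(2)])
    qed
    have eqf: "(\<integral>x. f k x \<partial>M) = (\<integral>x. f k x \<partial>N)" for k
      using bd by (intro eq cont) (auto simp: bounded_iff)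
    have "measure M F = measure N F"
      by (rule LIMSEQ_unique[OF conv[OF M]]) (use conv[OF N] in \<open>simp add: eqf\<close>)
    then show ?thesis by (simp add: M.emeasure_eq_measure N.emeasure_eq_measure)
  qed simp
qed auto

lemma is_infinite_convolution_unique:
  fixes \<nu> :: "nat \<Rightarrow> 'a::ordered_euclidean_space measure"
  assumes "is_infinite_convolution \<nu> \<mu>" "is_infinite_convolution \<nu> \<mu>'"
  shows "\<mu> = \<mu>'"
proof (rule measure_eqI_bounded_continuous)
  fix f :: "'a \<Rightarrow> real" assume "continuous_on UNIV f" "bounded (range f)"
  then show "(\<integral>x. f x \<partial>\<mu>) = (\<integral>x. f x \<partial>\<mu>')"
    using assms unfolding is_infinite_convolution_def converges_weakly_def
    by (blast intro: LIMSEQ_unique)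
qed (use assms in \<open>auto simp: is_infinite_convolution_def prob_space_def\<close>)

lemma infinite_convolution_eqI:
  assumes "is_infinite_convolution \<nu> \<mu>"
  shows "infinite_convolution \<nu> = \<mu>"
  unfolding infinite_convolution_def
  using assms by (intro the_equality) (auto intro: is_infinite_convolution_unique)

text \<open>Young's inequality with a free weight: t = 1 serves rough splittings, while the
  contraction takes t = s to keep the factor on the main term small.\<close>

lemma cmod_add_sq_le:
  assumes "t > 0"
  shows "(cmod (a + b))\<^sup>2 \<le> (1 + t) * (cmod a)\<^sup>2 + (1 + 1 / t) * (cmod b)\<^sup>2"
proof -
  define x where "x = cmod a"
  define y where "y = cmod b"
  have "cmod (a + b) \<le> x + y" unfolding x_def y_def by (rule norm_triangle_ineq)
  then have "(cmod (a + b))\<^sup>2 \<le> (x + y)\<^sup>2" by (intro power_mono) auto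
  also have "\<dots> = (1 + t) * x\<^sup>2 + (1 + 1 / t) * y\<^sup>2 - (t * x - y)\<^sup>2 / t"
    using assms by (simp add: field_simps power2_eq_square)
  also have "\<dots> \<le> (1 + t) * x\<^sup>2 + (1 + 1 / t) * y\<^sup>2" using assms by simp
  finally show ?thesis unfolding x_def y_def .
qed

section \<open>Density of the bounded continuous functions in L2\<close>

lemma bounded_range_sq:
  assumes "bounded (range f)"
  shows "bounded (range (\<lambda>x. (cmod (f x))\<^sup>2))"
proof -
  obtain K where "\<And>x. cmod (f x) \<le> K" using assms unfolding bounded_iff by auto
  then have "norm ((cmod (f x))\<^sup>2) \<le> K\<^sup>2" for x by (auto intro: power_mono)
  then show ?thesis unfolding bounded_iff by blast
qed

lemma bounded_range_add:
  fixes f g :: "'a \<Rightarrow> 'b::real_normed_vector"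
  assumes "bounded (range f)" "bounded (range g)"
  shows "bounded (range (\<lambda>x. f x + g x))"
proof -
  obtain K L where "\<And>x. norm (f x) \<le> K" "\<And>x. norm (g x) \<le> L" using assms unfolding bounded_iff by auto
  then have "norm (f x + g x) \<le> K + L" for x by (meson add_mono norm_triangle_le)
  then show ?thesis unfolding bounded_iff by blast
qed

lemma bounded_range_cmult:
  fixes f :: "'a \<Rightarrow> 'b::real_normed_algebra"
  assumes "bounded (range f)"
  shows "bounded (range (\<lambda>x. c * f x))"
proof -
  obtain K where "\<And>x. norm (f x) \<le> K" using assms unfolding bounded_iff by auto
  then have "norm (c * f x) \<le> norm c * K" for x
    by (meson dual_order.trans mult_left_mono norm_ge_zero norm_mult_ineq)
  then show ?thesis unfolding bounded_iff by blast
qed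

lemma bounded_range_diff:
  fixes f g :: "'a \<Rightarrow> 'b::real_normed_vector"
  assumes "bounded (range f)" "bounded (range g)"
  shows "bounded (range (\<lambda>x. f x - g x))"
proof -
  have "bounded (range (\<lambda>x. - g x))" using assms(2) unfolding bounded_iff by auto
  from bounded_range_add[OF assms(1) this] show ?thesis by simp
qed

text \<open>Meaningful only for square integrable f: the Bochner integral of a non-integrable
  function is 0, so the condition could hold for the wrong reason. Adding functions therefore asks
  for \<open>square_integrable\<close> as well.\<close>

definition L2_approx :: "'a::topological_space measure \<Rightarrow> ('a \<Rightarrow> complex) \<Rightarrow> bool" where
  "L2_approx M f \<longleftrightarrow> (\<forall>e>0. \<exists>\<phi>. continuous_on UNIV \<phi> \<and> bounded (range \<phi>) \<and>
     (\<integral>x. (cmod (f x - \<phi> x))\<^sup>2 \<partial>M) < e)"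

text \<open>Regularity squeezes A between a compact K and an open U with
  \<open>measure M (U - K) < e\<close>. A Urysohn function that is 1 on K and 0 off U differs from
  the indicator only on U - K, and there by at most 1.\<close>

lemma L2_approx_indicator:
  fixes M :: "'a::euclidean_space measure"
  assumes M: "finite_measure M" "sets M = sets borel" and A: "A \<in> sets borel"
  shows "L2_approx M (indicator A)"
  unfolding L2_approx_def
proof (intro allI impI)
  interpret finite_measure M by fact
  fix e :: real assume e: "e > 0"
  have fin: "emeasure M (space M) \<noteq> \<infinity>" by simp
  have "\<exists>K. K \<subseteq> A \<and> compact K \<and> measure M A < measure M K + e / 2"
  proof -
    have "(SUP K \<in> {K. K \<subseteq> A \<and> compact K}. emeasure M K) = emeasure M A"
      using inner_regular[OF M(2) fin A] by simp
    show ?thesis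
    \<comment> \<open>\<open>ennreal\<close> truncates negative numbers to 0, so
      \<open>measure M A - e / 2\<close> serves as a strict lower level only when it is nonnegative;
      otherwise the empty compact set is good enough.\<close>
    proof (cases "measure M A < e / 2")
      case True
      then show ?thesis by (intro exI[of _ "{}"]) auto
    next
      case False
      have "ennreal (measure M A - e / 2) < emeasure M A"
        using False e by (simp add: emeasure_eq_measure ennreal_less_iff)
      also have "\<dots> = (SUP K \<in> {K. K \<subseteq> A \<and> compact K}. emeasure M K)"
        by (rule inner_regular[OF M(2) fin A])
      finally obtain K where "K \<subseteq> A" "compact K" "ennreal (measure M A - e / 2) < emeasure M K"
        unfolding less_SUP_iff by auto
      then show ?thesis using False e by (intro exI[of _ K]) (auto simp: emeasure_eq_measure ennreal_less_iff)
    qed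
  qed
  then obtain K where K: "K \<subseteq> A" "compact K" "measure M A < measure M K + e / 2" by blast
  have "emeasure M A < ennreal (measure M A + e / 2)"
    using e by (simp add: emeasure_eq_measure ennreal_less_iff)
  then have "(INF U \<in> {U. A \<subseteq> U \<and> open U}. emeasure M U) < ennreal (measure M A + e / 2)"
    unfolding outer_regular[OF M(2) fin A] .
  then obtain U where U: "A \<subseteq> U" "open U" "emeasure M U < ennreal (measure M A + e / 2)"
    unfolding INF_less_iff by auto
  have U3: "measure M U < measure M A + e / 2"
    using U(3) e by (simp add: emeasure_eq_measure ennreal_less_iff del: ennreal_plus)
  have mK: "K \<in> sets M" "U \<in> sets M" using K(2) U(2) M(2) by (auto intro: borel_compact)
  obtain \<phi> :: "'a \<Rightarrow> real" where \<phi>: "continuous_on UNIV \<phi>" "\<And>x. \<phi> x \<in> closed_segment 0 1"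
    "\<And>x. x \<in> K \<Longrightarrow> \<phi> x = 1" "\<And>x. x \<in> - U \<Longrightarrow> \<phi> x = 0"
  proof (rule Urysohn)
    show "closed (- U)" "closed K" "(- U) \<inter> K = {}"
      using K(1,2) U(1,2) by (auto intro: compact_imp_closed)
  qed blast
  have \<phi>01: "0 \<le> \<phi> x" "\<phi> x \<le> 1" for x using \<phi>(2)[of x] by (auto simp: closed_segment_eq_real_ivl)
  let ?\<phi> = "\<lambda>x. complex_of_real (\<phi> x)"
  have le: "(cmod (indicator A x - ?\<phi> x))\<^sup>2 \<le> indicator (U - K) x" for x
  proof (cases "x \<in> U - K")
    case True
    have "cmod (indicator A x - ?\<phi> x) = \<bar>indicator A x - \<phi> x\<bar>"
      by (metis norm_of_real of_real_diff of_real_indicator)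
    also have "\<dots> \<le> 1" using \<phi>01[of x] by (auto simp: indicator_def)
    finally show ?thesis using True by (simp add: power_le_one)
  next
    case False
    then show ?thesis using \<phi>(3,4)[of x] K(1) U(1) by (auto simp: indicator_def)
  qed
  have "(\<integral>x. (cmod (indicator A x - ?\<phi> x))\<^sup>2 \<partial>M) \<le> (\<integral>x. indicator (U - K) x \<partial>M)"
    using le mK by (intro integral_mono') (auto intro!: integrable_real_indicator simp: emeasure_eq_measure)
  also have "\<dots> = measure M (U - K)"
    using mK by (simp add: Int_absorb2 sets.sets_into_space)
  also have "\<dots> = measure M U - measure M K"
    using mK K U by (intro finite_measure_Diff) auto
  also have "\<dots> < e" using U3 K(3) by linarith
  finally show "\<exists>\<phi>. continuous_on UNIV \<phi> \<and> bounded (range \<phi>) \<and>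
     (\<integral>x. (cmod (indicator A x - \<phi> x))\<^sup>2 \<partial>M) < e"
    using \<phi>01 \<phi>(1) by (intro exI[of _ ?\<phi>]) (auto intro!: continuous_intros boundedI[where B=1])
qed

lemma L2_approx_cmult:
  assumes "L2_approx M f"
  shows "L2_approx M (\<lambda>x. f x * c)"
  unfolding L2_approx_def
proof (intro allI impI)
  fix e :: real assume e: "e > 0"
  \<comment> \<open>The summand 1 keeps \<open>e / k\<close> meaningful for c = 0.\<close>
  define k where "k = (cmod c)\<^sup>2 + 1"
  have k: "k > 0" "(cmod c)\<^sup>2 \<le> k" unfolding k_def by (auto intro: add_nonneg_pos)
  obtain \<phi> where \<phi>: "continuous_on UNIV \<phi>" "bounded (range \<phi>)" "(\<integral>x. (cmod (f x - \<phi> x))\<^sup>2 \<partial>M) < e / k"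
    using assms e k unfolding L2_approx_def by (metis divide_pos_pos)
  have "(\<integral>x. (cmod (f x * c - \<phi> x * c))\<^sup>2 \<partial>M) = (cmod c)\<^sup>2 * (\<integral>x. (cmod (f x - \<phi> x))\<^sup>2 \<partial>M)"
    unfolding left_diff_distrib[symmetric] norm_mult power_mult_distrib by simp
  also have "\<dots> \<le> k * (\<integral>x. (cmod (f x - \<phi> x))\<^sup>2 \<partial>M)"
    using k by (intro mult_right_mono) auto
  also have "\<dots> < e" using \<phi>(3) k by (simp add: field_simps)
  finally show "\<exists>\<phi>. continuous_on UNIV \<phi> \<and> bounded (range \<phi>) \<and> (\<integral>x. (cmod (f x * c - \<phi> x))\<^sup>2 \<partial>M) < e"
    using \<phi>(1,2) bounded_range_cmult[of \<phi> c]
    by (intro exI[of _ "\<lambda>x. \<phi> x * c"]) (auto intro!: continuous_intros simp: mult.commute)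
qed

lemma square_integrable_diff_bounded:
  assumes "finite_measure M" "square_integrable M f" "g \<in> borel_measurable M" "bounded (range g)"
  shows "integrable M (\<lambda>x. (cmod (f x - g x))\<^sup>2)"
proof (rule Bochner_Integration.integrable_bound)
  interpret finite_measure M by fact
  have [measurable]: "f \<in> borel_measurable M" using assms(2) unfolding square_integrable_def by simp
  note assms(3)[measurable]
  show "integrable M (\<lambda>x. 2 * (cmod (f x))\<^sup>2 + 2 * (cmod (g x))\<^sup>2)"
    using assms(2) integrable_bounded[OF _ bounded_range_sq[OF assms(4)]] unfolding square_integrable_def by auto
  show "AE x in M. norm ((cmod (f x - g x))\<^sup>2) \<le> norm (2 * (cmod (f x))\<^sup>2 + 2 * (cmod (g x))\<^sup>2)"
    using cmod_add_sq_le[of 1 "f _" "- g _"] by auto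
  show "(\<lambda>x. (cmod (f x - g x))\<^sup>2) \<in> borel_measurable M" by measurable
qed

lemma L2_approx_add:
  assumes M: "finite_measure M" "sets M = sets borel"
    and f: "square_integrable M f" "L2_approx M f" and g: "square_integrable M g" "L2_approx M g"
  shows "L2_approx M (\<lambda>x. f x + g x)"
  unfolding L2_approx_def
proof (intro allI impI)
  interpret finite_measure M by fact
  fix e :: real assume e: "e > 0"
  obtain \<phi> where \<phi>: "continuous_on UNIV \<phi>" "bounded (range \<phi>)" "(\<integral>x. (cmod (f x - \<phi> x))\<^sup>2 \<partial>M) < e / 4"
    using f(2) e unfolding L2_approx_def by (metis zero_less_divide_iff zero_less_numeral)
  obtain \<psi> where \<psi>: "continuous_on UNIV \<psi>" "bounded (range \<psi>)" "(\<integral>x. (cmod (g x - \<psi> x))\<^sup>2 \<partial>M) < e / 4"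
    using g(2) e unfolding L2_approx_def by (metis zero_less_divide_iff zero_less_numeral)
  have [measurable]: "f \<in> borel_measurable M" "g \<in> borel_measurable M"
    using f g unfolding square_integrable_def by auto
  have [measurable]: "\<phi> \<in> borel_measurable M" "\<psi> \<in> borel_measurable M"
    using \<phi>(1) \<psi>(1) M(2) continuous_borel_measurable by blast+
  note int = square_integrable_diff_bounded[OF M(1) f(1) _ \<phi>(2)] square_integrable_diff_bounded[OF M(1) g(1) _ \<psi>(2)]
  have "(\<integral>x. (cmod (f x + g x - (\<phi> x + \<psi> x)))\<^sup>2 \<partial>M) \<le>
      (\<integral>x. 2 * (cmod (f x - \<phi> x))\<^sup>2 + 2 * (cmod (g x - \<psi> x))\<^sup>2 \<partial>M)"
  proof (rule integral_mono')
    show "integrable M (\<lambda>x. 2 * (cmod (f x - \<phi> x))\<^sup>2 + 2 * (cmod (g x - \<psi> x))\<^sup>2)"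
      using int by auto
    show "(cmod (f x + g x - (\<phi> x + \<psi> x)))\<^sup>2 \<le> 2 * (cmod (f x - \<phi> x))\<^sup>2 + 2 * (cmod (g x - \<psi> x))\<^sup>2" for x
      using cmod_add_sq_le[of 1 "f x - \<phi> x" "g x - \<psi> x"] by (simp add: algebra_simps)
  qed auto
  also have "\<dots> = 2 * (\<integral>x. (cmod (f x - \<phi> x))\<^sup>2 \<partial>M) + 2 * (\<integral>x. (cmod (g x - \<psi> x))\<^sup>2 \<partial>M)"
    using int by simp
  also have "\<dots> < e" using \<phi>(3) \<psi>(3) by simp
  finally show "\<exists>\<phi>. continuous_on UNIV \<phi> \<and> bounded (range \<phi>) \<and> (\<integral>x. (cmod (f x + g x - \<phi> x))\<^sup>2 \<partial>M) < e"
    using \<phi>(1,2) \<psi>(1,2) bounded_range_add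
    by (intro exI[of _ "\<lambda>x. \<phi> x + \<psi> x"]) (auto intro!: continuous_intros)
qed

lemma L2_approx_simple:
  fixes M :: "'a::euclidean_space measure"
  assumes M: "finite_measure M" "sets M = sets borel" and s: "simple_function M s"
  shows "square_integrable M s" "L2_approx M s"
proof -
  interpret finite_measure M by fact
  have sp: "space M = UNIV" using sets_eq_imp_space_eq[OF M(2)] by simp
  have main: "square_integrable M (\<lambda>x. \<Sum>y\<in>Y. indicator (s -` {y}) x * y) \<and>
      L2_approx M (\<lambda>x. \<Sum>y\<in>Y. indicator (s -` {y}) x * y)" if "finite Y" for Y
    using that
  proof induction
    case empty
    have "L2_approx M (\<lambda>x. indicator {} x * 0)"
      by (intro L2_approx_cmult L2_approx_indicator M) auto
    then show ?case by (simp add: square_integrable_def)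
  next
    case (insert y Y)
    have A: "s -` {y} \<in> sets borel"
      using simple_functionD(2)[OF s, of "{y}"] M(2) sp by simp
    have si: "square_integrable M (\<lambda>x. \<Sum>y\<in>Z. indicator (s -` {y}) x * y)" if "finite Z" for Z
    proof -
      have B: "s -` {y} \<in> sets M" for y
        using simple_functionD(2)[OF s, of "{y}"] M(2) sp by simp
      have me: "(\<lambda>x. \<Sum>y\<in>Z. indicator (s -` {y}) x * y) \<in> borel_measurable M"
        using B by measurable
      have "cmod (\<Sum>y\<in>Z. indicator (s -` {y}) x * y) \<le> (\<Sum>y\<in>Z. cmod y)" for x
        by (intro order_trans[OF norm_sum] sum_mono) (auto simp: indicator_def)
      then have "bounded (range (\<lambda>x. \<Sum>y\<in>Z. indicator (s -` {y}) x * y))"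
        unfolding bounded_iff by blast
      from bounded_range_sq[OF this] me show ?thesis
        unfolding square_integrable_def by (intro conjI integrable_bounded) auto
    qed
    have "square_integrable M (\<lambda>x. indicator (s -` {y}) x * y)" using si[of "{y}"] by (simp only: sum.insert sum.empty finite.emptyI finite_insert empty_iff not_False_eq_True add_0_right)
    then have "L2_approx M (\<lambda>x. indicator (s -` {y}) x * y + (\<Sum>y\<in>Y. indicator (s -` {y}) x * y))"
      using insert by (intro L2_approx_add[OF M] L2_approx_cmult L2_approx_indicator M A) auto
    then show ?case using insert.hyps si[of "insert y Y"]
      by (simp only: sum.insert finite_insert simp_thms)
  qed
  have s_eq: "s = (\<lambda>x. \<Sum>y\<in>range s. indicator (s -` {y}) x * y)"
  proof
    fix x
    have "s x = (\<Sum>y\<in>range s. indicator (s -` {y}) x *\<^sub>R y)"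
      using simple_function_indicator_representation_banach[OF s, of x] sp by (simp only: Int_UNIV_right UNIV_I)
    also have "\<dots> = (\<Sum>y\<in>range s. indicator (s -` {y}) x * y)"
      by (simp only: scaleR_conv_of_real of_real_indicator)
    finally show "s x = (\<Sum>y\<in>range s. indicator (s -` {y}) x * y)" .
  qed
  have "finite (range s)" using simple_functionD(1)[OF s] sp by simp
  from main[OF this] show "square_integrable M s" "L2_approx M s"
    unfolding s_eq[symmetric] by simp_all
qed

lemma L2_approx_square_integrable:
  fixes M :: "'a::euclidean_space measure"
  assumes M: "finite_measure M" "sets M = sets borel" and f: "square_integrable M f"
  shows "L2_approx M f"
  unfolding L2_approx_def
proof (intro allI impI)
  interpret finite_measure M by fact
  fix e :: real assume e: "e > 0"
  have fm[measurable]: "f \<in> borel_measurable M" and fi: "integrable M (\<lambda>x. (cmod (f x))\<^sup>2)"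
    using f unfolding square_integrable_def by auto
  obtain s where s: "\<And>i. simple_function M (s i)" "\<And>x. x \<in> space M \<Longrightarrow> (\<lambda>i. s i x) \<longlonglongrightarrow> f x"
    "\<And>i x. x \<in> space M \<Longrightarrow> norm (s i x) \<le> 2 * norm (f x)"
    using borel_measurable_implies_sequence_metric[OF fm] unfolding norm_conv_dist by metis
  have sm[measurable]: "s i \<in> borel_measurable M" for i by (rule borel_measurable_simple_function[OF s(1)])
  \<comment> \<open>The simple functions are at most 2 |f| in modulus, so the difference is at most
    3 |f|; its square 9 |f|^2 is the integrable majorant.\<close>
  have dom: "norm ((cmod (f x - s i x))\<^sup>2) \<le> 9 * (cmod (f x))\<^sup>2" if "x \<in> space M" for i x
  proof -
    have "cmod (f x - s i x) \<le> 3 * cmod (f x)"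
      using s(3)[OF that, of i] norm_triangle_ineq4[of "f x" "s i x"] by linarith
    then have "(cmod (f x - s i x))\<^sup>2 \<le> (3 * cmod (f x))\<^sup>2" by (intro power_mono) auto
    then show ?thesis by simp
  qed
  have "(\<lambda>i. \<integral>x. (cmod (f x - s i x))\<^sup>2 \<partial>M) \<longlonglongrightarrow> (\<integral>x. 0 \<partial>M)"
  proof (rule integral_dominated_convergence[where w = "\<lambda>x. 9 * (cmod (f x))\<^sup>2"])
    show "AE x in M. (\<lambda>i. (cmod (f x - s i x))\<^sup>2) \<longlonglongrightarrow> 0"
    proof (rule AE_I2)
      fix x assume "x \<in> space M"
      then have "(\<lambda>i. (cmod (f x - s i x))\<^sup>2) \<longlonglongrightarrow> (cmod (f x - f x))\<^sup>2"
        by (intro tendsto_intros s)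
      then show "(\<lambda>i. (cmod (f x - s i x))\<^sup>2) \<longlonglongrightarrow> 0" by simp
    qed
    show "\<And>i. AE x in M. norm ((cmod (f x - s i x))\<^sup>2) \<le> 9 * (cmod (f x))\<^sup>2" using dom by (intro AE_I2) auto
    show "integrable M (\<lambda>x. 9 * (cmod (f x))\<^sup>2)" using fi by simp
  qed simp_all
  then have "(\<lambda>i. \<integral>x. (cmod (f x - s i x))\<^sup>2 \<partial>M) \<longlonglongrightarrow> 0" by simp
  then have "eventually (\<lambda>i. (\<integral>x. (cmod (f x - s i x))\<^sup>2 \<partial>M) < e / 4) sequentially"
    using e by (intro order_tendstoD) auto
  then obtain i where i: "(\<integral>x. (cmod (f x - s i x))\<^sup>2 \<partial>M) < e / 4"
    unfolding eventually_sequentially by blast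
  obtain \<phi> where \<phi>: "continuous_on UNIV \<phi>" "bounded (range \<phi>)" "(\<integral>x. (cmod (s i x - \<phi> x))\<^sup>2 \<partial>M) < e / 4"
    using L2_approx_simple(2)[OF M s(1)[of i]] e unfolding L2_approx_def by (metis zero_less_divide_iff zero_less_numeral)
  have [measurable]: "\<phi> \<in> borel_measurable M"
    using \<phi>(1) M(2) continuous_borel_measurable by blast
  have int1: "integrable M (\<lambda>x. (cmod (s i x - \<phi> x))\<^sup>2)"
    by (rule square_integrable_diff_bounded[OF M(1) L2_approx_simple(1)[OF M s(1)] _ \<phi>(2)]) measurable
  have int2: "integrable M (\<lambda>x. (cmod (f x - s i x))\<^sup>2)"
  proof (rule Bochner_Integration.integrable_bound[of M "\<lambda>x. 9 * (cmod (f x))\<^sup>2"])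
    show "AE x in M. norm ((cmod (f x - s i x))\<^sup>2) \<le> norm (9 * (cmod (f x))\<^sup>2)"
      using dom[of _ i] by (intro AE_I2) simp
  qed (use fi in simp_all)
  have "(\<integral>x. (cmod (f x - \<phi> x))\<^sup>2 \<partial>M) \<le>
      (\<integral>x. 2 * (cmod (f x - s i x))\<^sup>2 + 2 * (cmod (s i x - \<phi> x))\<^sup>2 \<partial>M)"
  proof (rule integral_mono')
    show "(cmod (f x - \<phi> x))\<^sup>2 \<le> 2 * (cmod (f x - s i x))\<^sup>2 + 2 * (cmod (s i x - \<phi> x))\<^sup>2" for x
      using cmod_add_sq_le[of 1 "f x - s i x" "s i x - \<phi> x"] by simp
  qed (use int1 int2 in auto)
  also have "\<dots> = 2 * (\<integral>x. (cmod (f x - s i x))\<^sup>2 \<partial>M) + 2 * (\<integral>x. (cmod (s i x - \<phi> x))\<^sup>2 \<partial>M)"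
    using int1 int2 by simp
  also have "\<dots> < e" using \<phi>(3) i by simp
  finally show "\<exists>\<phi>. continuous_on UNIV \<phi> \<and> bounded (range \<phi>) \<and> (\<integral>x. (cmod (f x - \<phi> x))\<^sup>2 \<partial>M) < e"
    using \<phi>(1,2) by (intro exI[of _ \<phi>]) simp
qed

section \<open>Infinite convolutions of finite averages\<close>

lemma measurable_uniform_count_measure [simp]:
  "f \<in> uniform_count_measure A \<rightarrow>\<^sub>M N \<longleftrightarrow> f ` A \<subseteq> space N"
  by (auto simp: measurable_def space_uniform_count_measure sets_uniform_count_measure Pi_iff image_subset_iff)

lemma sets_dirac_average [simp]: "sets (dirac_average A) = sets borel"
  unfolding dirac_average_def by simp

lemma prob_space_dirac_average:
  assumes "finite A" "A \<noteq> {}"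
  shows "prob_space (dirac_average A)"
  unfolding dirac_average_def
  by (rule prob_space.prob_space_distr[OF prob_space_uniform_count_measure[OF assms]]) simp

lemma integral_dirac_average:
  fixes f :: "'a::topological_space \<Rightarrow> real"
  assumes "finite A" "f \<in> borel_measurable borel"
  shows "(\<integral>x. f x \<partial>dirac_average A) = (\<Sum>a\<in>A. f a) / real (card A)"
  unfolding dirac_average_def using assms
  by (subst integral_distr) (auto simp: integral_uniform_count_measure)

lemma prob_space_convolution:
  assumes "prob_space M" "prob_space N" "sets M = sets borel" "sets N = sets borel"
  shows "prob_space (M \<star> N)"
proof -
  interpret M: prob_space M by fact
  interpret N: prob_space N by fact
  interpret pair_prob_space M N ..
  note assms(3,4)[measurable_cong]
  show ?thesis unfolding convolution_def by (rule prob_space_distr) measurable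
qed

lemma integral_convolution:
  fixes f :: "'a::ordered_euclidean_space \<Rightarrow> real"
  assumes "prob_space M" "prob_space N" "sets M = sets borel" "sets N = sets borel"
    and f[measurable]: "f \<in> borel_measurable borel" and bd: "bounded (range f)"
  shows "(\<integral>x. f x \<partial>(M \<star> N)) = (\<integral>x. (\<integral>y. f (x + y) \<partial>N) \<partial>M)"
proof -
  interpret M: prob_space M by fact
  interpret N: prob_space N by fact
  interpret pair_prob_space M N ..
  note assms(3,4)[measurable_cong]
  have "bounded (range (\<lambda>z. f (fst z + snd z)))"
    by (rule bounded_subset[OF bd]) auto
  then have "integrable (M \<Otimes>\<^sub>M N) (\<lambda>z. f (fst z + snd z))"
    by (intro integrable_bounded) auto
  then have "(\<integral>z. f (fst z + snd z) \<partial>(M \<Otimes>\<^sub>M N)) = (\<integral>x. (\<integral>y. f (x + y) \<partial>N) \<partial>M)"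
    using integral_fst' by fastforce
  then show ?thesis
    unfolding convolution_def by (subst integral_distr) (auto simp: case_prod_unfold)
qed

lemma convolution_return_0:
  fixes M :: "'a::ordered_euclidean_space measure"
  assumes "prob_space M" "sets M = sets borel"
  shows "M \<star> return borel 0 = M"
proof (rule measure_eqI_bounded_continuous)
  have r: "prob_space (return borel (0::'a))" by (rule prob_space_return) simp
  show "finite_measure M" using assms(1) by (simp add: prob_space_def)
  show "finite_measure (M \<star> return borel 0)"
    using prob_space_convolution[OF assms(1) r assms(2)] by (simp add: prob_space_def)
  fix f :: "'a \<Rightarrow> real" assume f: "continuous_on UNIV f" "bounded (range f)"
  have [measurable]: "f \<in> borel_measurable borel" using f(1) by (rule borel_measurable_continuous_onI)
  have "(\<integral>x. f x \<partial>(M \<star> return borel 0)) = (\<integral>x. (\<integral>y. f (x + y) \<partial>return borel 0) \<partial>M)"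
    by (rule integral_convolution[OF assms(1) r assms(2)]) (use f in auto)
  also have "\<dots> = (\<integral>x. f x \<partial>M)" by (subst integral_return) auto
  finally show "(\<integral>x. f x \<partial>(M \<star> return borel 0)) = (\<integral>x. f x \<partial>M)" .
qed (use assms in auto)

lemma finite_convolution_prob:
  assumes "\<And>k. prob_space (\<nu> k)" "\<And>k. sets (\<nu> k) = sets borel"
  shows "prob_space (finite_convolution \<nu> n) \<and> sets (finite_convolution \<nu> n) = sets borel"
proof (induction n)
  case 0
  then show ?case by (simp add: prob_space_return)
next
  case (Suc n)
  then show ?case using prob_space_convolution[OF _ assms(1) _ assms(2)] by simp
qed

lemma finite_convolution_add:
  assumes \<nu>: "\<And>k. prob_space (\<nu> k)" "\<And>k. sets (\<nu> k) = sets borel"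
  shows "finite_convolution \<nu> (n + m) = (finite_convolution \<nu> n \<star> finite_convolution (\<lambda>k. \<nu> (n + k)) m)"
proof (induction m)
  case 0
  then show ?case using finite_convolution_prob[OF \<nu>] by (simp add: convolution_return_0)
next
  case (Suc m)
  note fc = finite_convolution_prob[OF \<nu>] finite_convolution_prob[of "\<lambda>k. \<nu> (n + k)", OF \<nu>]
  have fin: "finite_measure (\<nu> k)" for k using \<nu>(1) by (rule prob_space.axioms(1))
  have "finite_convolution \<nu> (n + Suc m) =
      ((finite_convolution \<nu> n \<star> finite_convolution (\<lambda>k. \<nu> (n + k)) m) \<star> \<nu> (n + m))"
    using Suc by simp
  also have "\<dots> = (finite_convolution \<nu> n \<star> (finite_convolution (\<lambda>k. \<nu> (n + k)) m \<star> \<nu> (n + m)))"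
    by (rule convolution_associative[symmetric])
      (simp_all add: fc fin \<nu> prob_space.axioms(1))
  finally show ?case by simp
qed

text \<open>The remaining factors stay a finite convolution, so the identity is available before any
  tail limit is known. It serves both to bound the partial sums and, in the limit, to disintegrate
  the infinite convolution.\<close>

lemma finite_convolution_average:
  fixes \<nu> :: "nat \<Rightarrow> 'a::ordered_euclidean_space measure"
  assumes \<nu>: "\<And>k. prob_space (\<nu> k)" "\<And>k. sets (\<nu> k) = sets borel"
    and S: "finite S" "finite_convolution \<nu> n = dirac_average S"
    and f: "continuous_on UNIV f" "bounded (range f)"
  shows "(\<Sum>b\<in>S. \<integral>y. f (b + y) \<partial>finite_convolution (\<lambda>k. \<nu> (n + k)) m) / real (card S)
      = (\<integral>x. f x \<partial>finite_convolution \<nu> (n + m))"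
proof -
  let ?T = "finite_convolution (\<lambda>k. \<nu> (n + k)) m"
  have [measurable]: "f \<in> borel_measurable borel" using f(1) by (rule borel_measurable_continuous_onI)
  note fcT = finite_convolution_prob[of "\<lambda>k. \<nu> (n + k)", OF \<nu>]
  interpret T: prob_space ?T using fcT by blast
  have [measurable_cong]: "sets ?T = sets borel" using fcT by blast
  have "(\<integral>x. f x \<partial>finite_convolution \<nu> (n + m)) = (\<integral>x. (\<integral>y. f (x + y) \<partial>?T) \<partial>finite_convolution \<nu> n)"
    unfolding finite_convolution_add[OF \<nu>]
    using finite_convolution_prob[OF \<nu>] fcT f(2) by (intro integral_convolution) auto
  also have "\<dots> = (\<Sum>b\<in>S. \<integral>y. f (b + y) \<partial>?T) / real (card S)"
    unfolding S(2) by (rule integral_dirac_average[OF S(1)]) measurable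
  finally show ?thesis by simp
qed

text \<open>Let m tend to infinity in \<open>finite_convolution_average\<close>; a translate of a
  bounded continuous test function is again one.\<close>

lemma infinite_convolution_disintegration:
  fixes \<nu> :: "nat \<Rightarrow> 'a::ordered_euclidean_space measure"
  assumes \<nu>: "\<And>k. prob_space (\<nu> k)" "\<And>k. sets (\<nu> k) = sets borel"
    and \<mu>: "is_infinite_convolution \<nu> \<mu>"
    and \<tau>: "is_infinite_convolution (\<lambda>k. \<nu> (n + k)) \<tau>"
    and S: "finite S" "finite_convolution \<nu> n = dirac_average S"
    and f: "continuous_on UNIV f" "bounded (range f)"
  shows "(\<integral>x. f x \<partial>\<mu>) = (\<Sum>b\<in>S. \<integral>y. f (b + y) \<partial>\<tau>) / real (card S)"
proof -
  let ?T = "\<lambda>m. finite_convolution (\<lambda>k. \<nu> (n + k)) m"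
  have "(\<lambda>m. \<integral>x. f x \<partial>finite_convolution \<nu> (m + n)) \<longlonglongrightarrow> (\<integral>x. f x \<partial>\<mu>)"
    using \<mu> f unfolding is_infinite_convolution_def converges_weakly_def by (intro LIMSEQ_ignore_initial_segment) blast
  then have 1: "(\<lambda>m. (\<Sum>b\<in>S. \<integral>y. f (b + y) \<partial>?T m) / real (card S)) \<longlonglongrightarrow> (\<integral>x. f x \<partial>\<mu>)"
    unfolding finite_convolution_average[OF \<nu> S f] by (simp add: add.commute)
  have "(\<lambda>m. \<integral>y. f (b + y) \<partial>?T m) \<longlonglongrightarrow> (\<integral>y. f (b + y) \<partial>\<tau>)" for b
  proof -
    have "continuous_on UNIV (\<lambda>y. f (b + y))"
      by (rule continuous_on_compose2[OF f(1)]) (auto intro!: continuous_intros)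
    moreover have "bounded (range (\<lambda>y. f (b + y)))" by (rule bounded_subset[OF f(2)]) auto
    ultimately show ?thesis using \<tau> unfolding is_infinite_convolution_def converges_weakly_def by blast
  qed
  then have 2: "(\<lambda>m. (\<Sum>b\<in>S. \<integral>y. f (b + y) \<partial>?T m) / real (card S)) \<longlonglongrightarrow> (\<Sum>b\<in>S. \<integral>y. f (b + y) \<partial>\<tau>) / real (card S)"
    unfolding divide_inverse by (intro tendsto_intros)
  show ?thesis using LIMSEQ_unique[OF 1 2] .
qed

text \<open>On the infinite product of the uniform spaces \<open>A k\<close> the coordinates are
  independent, so partial sums have the finite convolutions as laws. The majorant c makes the series
  converge at every sample point, and dominated convergence turns this into weak
  convergence.\<close>

lemma exists_infinite_convolution:
  fixes A :: "nat \<Rightarrow> 'a::ordered_euclidean_space set"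
  assumes A: "\<And>k. finite (A k)" "\<And>k. A k \<noteq> {}"
    and c: "\<And>k a. a \<in> A k \<Longrightarrow> norm a \<le> c k" "summable c"
  shows "\<exists>\<tau>. is_infinite_convolution (\<lambda>k. dirac_average (A k)) \<tau> \<and> (AE y in \<tau>. norm y \<le> suminf c)"
proof -
  let ?M = "\<lambda>k. uniform_count_measure (A k)"
  have pM: "prob_space (?M k)" for k using prob_space_uniform_count_measure[OF A] .
  interpret product_prob_space ?M UNIV by (rule product_prob_spaceI[OF pM])
  let ?P = "PiM UNIV ?M"
  have comp: "(\<lambda>\<omega>. \<omega> k) \<in> borel_measurable (PiM J ?M)" if "k \<in> J" for k J
    using measurable_compose[OF measurable_component_singleton[OF that, of ?M], of id borel] by (simp add: id_def)
  define S where "S m \<omega> = (\<Sum>k<m. \<omega> k)" for m and \<omega> :: "nat \<Rightarrow> 'a"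
  define T where "T \<omega> = suminf \<omega>" for \<omega> :: "nat \<Rightarrow> 'a"
  have Sm[measurable]: "S m \<in> borel_measurable ?P" for m
    unfolding S_def using comp by (intro borel_measurable_sum) auto
  have in_A: "\<omega> k \<in> A k" if "\<omega> \<in> space ?P" for \<omega> k
    using that by (auto simp: space_PiM space_uniform_count_measure)
  have sum\<omega>: "summable \<omega>" "norm (suminf \<omega>) \<le> suminf c" if "\<omega> \<in> space ?P" for \<omega>
  proof -
    have le: "norm (\<omega> k) \<le> c k" for k using c(1) in_A[OF that] by blast
    then show "summable \<omega>" by (intro summable_comparison_test[OF _ c(2)]) auto
    have "summable (\<lambda>k. norm (\<omega> k))" using le by (intro summable_comparison_test[OF _ c(2)]) auto
    then show "norm (suminf \<omega>) \<le> suminf c"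
      using summable_norm suminf_le[OF le _ c(2)] order_trans by blast
  qed
  have lim: "(\<lambda>m. S m \<omega>) \<longlonglongrightarrow> T \<omega>" if "\<omega> \<in> space ?P" for \<omega>
    unfolding S_def T_def using sum\<omega>(1)[OF that] by (rule summable_LIMSEQ)
  have Tm[measurable]: "T \<in> borel_measurable ?P"
    using lim Sm by (rule borel_measurable_LIMSEQ_metric[rotated])
  have indep: "indep_vars ?M (\<lambda>k \<omega>. \<omega> k) UNIV"
  proof (subst indep_vars_iff_distr_eq_PiM')
    have "distr ?P ?P (\<lambda>x. \<lambda>i\<in>UNIV. x i) = ?P" by (simp add: restrict_UNIV)
    also have "\<dots> = (\<Pi>\<^sub>M i\<in>UNIV. distr ?P (?M i) (\<lambda>\<omega>. \<omega> i))"
      by (intro PiM_cong refl) (simp add: PiM_component)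
    finally show "distr ?P ?P (\<lambda>x. \<lambda>i\<in>UNIV. x i) = (\<Pi>\<^sub>M i\<in>UNIV. distr ?P (?M i) (\<lambda>\<omega>. \<omega> i))" .
  qed auto
  have distr1: "distr ?P borel (\<lambda>\<omega>. \<omega> k) = dirac_average (A k)" for k
  proof -
    have "dirac_average (A k) = distr (distr ?P (?M k) (\<lambda>\<omega>. \<omega> k)) borel (\<lambda>x. x)"
      unfolding dirac_average_def by (simp add: PiM_component)
    also have "\<dots> = distr ?P borel (\<lambda>\<omega>. \<omega> k)"
      by (subst distr_distr) (auto simp: comp_def)
    finally show ?thesis ..
  qed
  have distrS: "distr ?P borel (S m) = finite_convolution (\<lambda>k. dirac_average (A k)) m" for m
  proof (induction m)
    case 0
    have "distr ?P borel (\<lambda>\<omega>. 0::'a) = return borel 0"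
      by (rule measure_eqI) (auto simp: emeasure_distr P.emeasure_space_1 indicator_def)
    then show ?case by (simp add: S_def[abs_def])
  next
    case (Suc m)
    \<comment> \<open>\<open>S m\<close> depends only on the coordinates below m, so it is
      independent of coordinate m and the law of the sum is a convolution.\<close>
    have "P.indep_var borel ((\<lambda>f. \<Sum>k<m. f k) \<circ> (\<lambda>\<omega>. restrict (\<lambda>i. \<omega> i) {..<m}))
        borel ((\<lambda>f. f m) \<circ> (\<lambda>\<omega>. restrict (\<lambda>i. \<omega> i) {m}))"
      by (rule P.indep_var_compose[OF P.indep_var_restrict[OF indep, of "{..<m}" "{m}"]])
        (auto intro!: borel_measurable_sum comp)
    then have "P.indep_var borel (S m) borel (\<lambda>\<omega>. \<omega> m)"
      by (simp add: comp_def S_def[abs_def])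
    from P.sum_indep_random_variable[OF this] have
      "distr ?P borel (\<lambda>\<omega>. S m \<omega> + \<omega> m) = (distr ?P borel (S m) \<star> distr ?P borel (\<lambda>\<omega>. \<omega> m))"
      using comp by auto
    then show ?case using Suc distr1 by (simp add: S_def[abs_def])
  qed
  let ?\<tau> = "distr ?P borel T"
  have "converges_weakly (finite_convolution (\<lambda>k. dirac_average (A k))) ?\<tau>"
    unfolding converges_weakly_def
  proof (intro allI impI)
    fix f :: "'a \<Rightarrow> real" assume f: "continuous_on UNIV f" "bounded (range f)"
    obtain K where K: "\<And>x. \<bar>f x\<bar> \<le> K" using f(2) unfolding bounded_iff by auto
    have [measurable]: "f \<in> borel_measurable borel" using f(1) by (rule borel_measurable_continuous_onI)
    have "(\<lambda>n. \<integral>\<omega>. f (S n \<omega>) \<partial>?P) \<longlonglongrightarrow> (\<integral>\<omega>. f (T \<omega>) \<partial>?P)"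
    proof (rule integral_dominated_convergence[where w = "\<lambda>_. K"])
      show "AE \<omega> in ?P. (\<lambda>n. f (S n \<omega>)) \<longlonglongrightarrow> f (T \<omega>)"
        using lim f(1) by (intro AE_I2) (auto intro: continuous_on_tendsto_compose)
    qed (use K in auto)
    then show "(\<lambda>n. \<integral>x. f x \<partial>finite_convolution (\<lambda>k. dirac_average (A k)) n) \<longlonglongrightarrow> (\<integral>x. f x \<partial>?\<tau>)"
      unfolding distrS[symmetric] by (simp add: integral_distr)
  qed
  moreover have "prob_space ?\<tau>" by (rule P.prob_space_distr) measurable
  moreover have "AE y in ?\<tau>. norm y \<le> suminf c"
    using sum\<omega>(2) unfolding T_def[symmetric] by (subst AE_distr_iff) auto
  ultimately show ?thesis unfolding is_infinite_convolution_def by (intro exI[of _ ?\<tau>]) simp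
qed

text \<open>The complement is a union of possibly uncountably many open null sets; Lindelof's
  theorem leaves countably many.\<close>

lemma emeasure_Compl_measure_support:
  fixes \<mu> :: "'a::second_countable_topology measure"
  assumes "sets \<mu> = sets borel"
  shows "emeasure \<mu> (- measure_support \<mu>) = 0"
proof -
  obtain \<U> :: "'a set set" where U: "\<U> \<subseteq> {U. open U \<and> emeasure \<mu> U = 0}" "countable \<U>"
    "\<Union>\<U> = \<Union>{U. open U \<and> emeasure \<mu> U = 0}"
    using Lindelof[of "{U. open U \<and> emeasure \<mu> U = 0}"] by auto
  have "- measure_support \<mu> = \<Union>{U. open U \<and> emeasure \<mu> U = 0}"
    unfolding measure_support_def by (auto simp: zero_less_iff_neq_zero)
  also have "\<dots> = (\<Union>U\<in>\<U>. U)" using U(3) by simp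
  finally have "- measure_support \<mu> = (\<Union>U\<in>\<U>. U)" .
  moreover have "(\<Union>U\<in>\<U>. U) \<in> null_sets \<mu>"
    using U(1,2) assms by (intro null_sets_UN' ) (auto simp: null_sets_def)
  ultimately show ?thesis by auto
qed

text \<open>Late partial convolutions put almost all their mass near the support of the limit. If \<open>0, b \<in> S\<close>, then
  the remaining factors and their translate by \<open>b\<close> both do so, which forces \<open>b\<close> to be bounded.\<close>
lemma partial_sums_bounded:
  fixes \<nu> :: "nat \<Rightarrow> 'a::ordered_euclidean_space measure"
  assumes \<nu>: "\<And>k. prob_space (\<nu> k)" "\<And>k. sets (\<nu> k) = sets borel"
    and \<mu>: "is_infinite_convolution \<nu> \<mu>" "compact (measure_support \<mu>)"
  obtains C where "\<And>n S b. finite S \<Longrightarrow> 0 \<in> S \<Longrightarrow> finite_convolution \<nu> n = dirac_average S \<Longrightarrow>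
    b \<in> S \<Longrightarrow> norm b \<le> C"
proof -
  obtain r where r: "\<And>x. x \<in> measure_support \<mu> \<Longrightarrow> norm x \<le> r"
    using compact_imp_bounded[OF \<mu>(2)] unfolding bounded_iff by blast
  \<comment> \<open>A continuous ramp: 0 on the ball of radius r, hence on the support of \<mu>, and
    1 beyond radius r + 1.\<close>
  define f where "f x = min 1 (max 0 (norm x - r))" for x :: 'a
  have fc: "continuous_on UNIV f" unfolding f_def by (intro continuous_intros)
  have f01: "0 \<le> f x" "f x \<le> 1" for x unfolding f_def by auto
  have fb: "bounded (range f)" using f01 by (auto intro!: boundedI[where B=1])
  have sets\<mu>: "sets \<mu> = sets borel" using \<mu>(1) unfolding is_infinite_convolution_def by blast
  have "AE x in \<mu>. f x = 0"
  proof (rule AE_I)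
    show "emeasure \<mu> (- measure_support \<mu>) = 0" by (rule emeasure_Compl_measure_support[OF sets\<mu>])
    show "- measure_support \<mu> \<in> sets \<mu>"
      using compact_imp_closed[OF \<mu>(2)] sets\<mu> by (simp add: borel_comp borel_closed Compl_in_sets_lebesgue)
    show "{x \<in> space \<mu>. f x \<noteq> 0} \<subseteq> - measure_support \<mu>"
      using r unfolding f_def by fastforce
  qed
  then have "(\<integral>x. f x \<partial>\<mu>) = 0" by (rule integral_eq_zero_AE)
  then have lim: "(\<lambda>n. \<integral>x. f x \<partial>finite_convolution \<nu> n) \<longlonglongrightarrow> 0"
    using \<mu>(1) fc fb unfolding is_infinite_convolution_def converges_weakly_def by metis
  have "norm b \<le> 2 * \<bar>r\<bar> + 2" if S: "finite S" "0 \<in> S" "finite_convolution \<nu> n = dirac_average S" and b: "b \<in> S"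
    for n S b
  proof -
    have cS: "real (card S) > 0" using S b by (auto simp: card_gt_0_iff)
    \<comment> \<open>An average of \<open>card S\<close> nonnegative integrals below this threshold
      leaves each of them below 1 / 2. The resulting m0 depends on n and S, but the final bound on b
      does not.\<close>
    have "eventually (\<lambda>n. (\<integral>x. f x \<partial>finite_convolution \<nu> n) < 1 / (2 * real (card S))) sequentially"
      using lim cS by (intro order_tendstoD(2)) auto
    then obtain m0 where m0: "\<And>m. m \<ge> m0 \<Longrightarrow> (\<integral>x. f x \<partial>finite_convolution \<nu> m) < 1 / (2 * real (card S))"
      unfolding eventually_sequentially by blast
    let ?T = "finite_convolution (\<lambda>k. \<nu> (n + k)) m0"
    interpret T: prob_space ?T using finite_convolution_prob[of "\<lambda>k. \<nu> (n + k)", OF \<nu>] by blast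
    have sT: "sets ?T = sets borel" using finite_convolution_prob[of "\<lambda>k. \<nu> (n + k)", OF \<nu>] by blast
    have fbc: "continuous_on UNIV (\<lambda>y. f (b + y))" for b
      by (rule continuous_on_compose2[OF fc]) (auto intro!: continuous_intros)
    have fbb: "bounded (range (\<lambda>y. f (b + y)))" for b by (rule bounded_subset[OF fb]) auto
    have int: "integrable ?T (\<lambda>y. f (b + y))" for b
      using T.finite_measure_axioms sT fbc fbb by (rule integrable_bounded_continuous)
    have small: "(\<integral>y. f (b + y) \<partial>?T) < 1 / 2" if b: "b \<in> S" for b
    proof -
      have "(\<integral>y. f (b + y) \<partial>?T) / real (card S) \<le> (\<Sum>b\<in>S. \<integral>y. f (b + y) \<partial>?T) / real (card S)"
        using S(1) b f01 by (intro divide_right_mono member_le_sum) (auto intro!: integral_nonneg_AE)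
      also have "\<dots> < 1 / (2 * real (card S))"
        unfolding finite_convolution_average[OF \<nu> S(1,3) fc fb] by (rule m0) simp
      finally show ?thesis using cS by (simp add: field_simps)
    qed
    \<comment> \<open>The two integrals add up to less than 1, so the integrand is below 1
      somewhere. There both values are below 1, which puts y and b + y within radius r + 1 of the
      origin, and b is their difference.\<close>
    have "\<exists>y. f (b + y) + f (0 + y) < 1"
    proof (rule ccontr)
      assume "\<not> ?thesis"
      then have ge: "1 \<le> f (b + y) + f (0 + y)" for y by (meson not_less)
      have "(\<integral>y. 1 \<partial>?T) \<le> (\<integral>y. f (b + y) + f (0 + y) \<partial>?T)"
        using int[of b] int[of 0] ge by (intro integral_mono) auto
      also have "\<dots> = (\<integral>y. f (b + y) \<partial>?T) + (\<integral>y. f (0 + y) \<partial>?T)"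
        by (rule Bochner_Integration.integral_add[OF int int])
      also have "\<dots> < 1" using small[OF b] small[OF S(2)] by simp
      finally show False by (simp add: T.prob_space)
    qed
    then obtain y where "f (b + y) + f y < 1" by auto
    then have "norm (b + y) < r + 1" "norm y < r + 1"
      using f01[of y] f01[of "b + y"] unfolding f_def by (auto simp: min_def max_def split: if_splits)
    moreover have "norm b \<le> norm (b + y) + norm y" by (metis add_diff_cancel_right' norm_triangle_ineq4)
    ultimately show ?thesis by linarith
  qed
  then show ?thesis using that by blast
qed

section \<open>Character sums of Hadamard triples\<close>

abbreviation unit_char :: "real \<Rightarrow> complex" where
  "unit_char x \<equiv> cis (2 * pi * x)"

lemma unit_char_add: "unit_char (x + y) = unit_char x * unit_char y"
  by (simp add: cis_mult distrib_left)

lemma unit_char_Ints: "x \<in> \<int> \<Longrightarrow> unit_char x = 1"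
  by (auto elim!: Ints_cases)

lemma matrix_inv_vector:
  fixes A :: "real ^ 'd ^ 'd"
  assumes "invertible A"
  shows "matrix_inv A *v (A *v x) = x" "A *v (matrix_inv A *v x) = x"
proof -
  have "\<exists>A'. A ** A' = mat 1 \<and> A' ** A = mat 1" using assms unfolding invertible_def .
  then have "A ** matrix_inv A = mat 1 \<and> matrix_inv A ** A = mat 1"
    unfolding matrix_inv_def by (rule someI_ex)
  then show "matrix_inv A *v (A *v x) = x" "A *v (matrix_inv A *v x) = x"
    by (simp_all add: matrix_vector_mul_assoc)
qed

lemma int_lattice_inner:
  assumes "x \<in> int_lattice" "y \<in> int_lattice"
  shows "x \<bullet> y \<in> \<int>"
  using assms unfolding int_lattice_def inner_vec_def by (auto intro!: Ints_sum)

lemma int_lattice_add: "x \<in> int_lattice \<Longrightarrow> y \<in> int_lattice \<Longrightarrow> x + y \<in> int_lattice"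
  and int_lattice_diff: "x \<in> int_lattice \<Longrightarrow> y \<in> int_lattice \<Longrightarrow> x - y \<in> int_lattice"
  and int_lattice_zero: "0 \<in> int_lattice"
  unfolding int_lattice_def by auto

lemma int_matrix_int_lattice:
  assumes "int_matrix A" "x \<in> int_lattice"
  shows "A *v x \<in> int_lattice"
  using assms unfolding int_matrix_def int_lattice_def matrix_vector_mult_def by (auto intro!: Ints_sum)

text \<open>A nonzero kernel vector would be an eigenvector for the eigenvalue 0, whose modulus is
  not above 1.\<close>

lemma expansive_invertible:
  fixes A :: "real ^ 'd ^ 'd"
  assumes "expansive A"
  shows "invertible A"
proof -
  have "x = 0" if "A *v x = 0" for x
  proof (rule ccontr)
    assume "x \<noteq> 0"
    then obtain i where "x $ i \<noteq> 0" by (metis vec_eq_iff zero_index)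
    moreover have "(\<Sum>j\<in>UNIV. complex_of_real (A $ i $ j) * complex_of_real (x $ j)) = 0" for i
    proof -
      have "(\<Sum>j\<in>UNIV. A $ i $ j * x $ j) = (A *v x) $ i" by (simp add: matrix_vector_mult_def)
      then have "(\<Sum>j\<in>UNIV. A $ i $ j * x $ j) = 0" using that by simp
      then show ?thesis by (metis (no_types, lifting) of_real_0 of_real_mult of_real_sum sum.cong)
    qed
    ultimately have "0 \<in> eigenvalues UNIV (\<lambda>i j. complex_of_real (A $ i $ j))"
      unfolding eigenvalues_def by (auto intro!: exI[of _ "\<lambda>i. complex_of_real (x $ i)"])
    then show False using assms unfolding expansive_def by force
  qed
  then have "\<exists>B. B ** A = mat 1" using matrix_left_invertible_ker by blast
  then show ?thesis using invertible_left_inverse by blast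
qed

text \<open>Unitarity freed of its normalisation. The column relations will separate digit sums and
  give Parseval on \<open>B_set\<close>; the row relations will separate frequencies and give
  orthonormality of the exponentials.\<close>

lemma hadamard_triple_sums:
  assumes "hadamard_triple R B L"
  shows "b \<in> B \<Longrightarrow> b' \<in> B \<Longrightarrow>
      (\<Sum>l\<in>L. unit_char ((matrix_inv R *v b - matrix_inv R *v b') \<bullet> l)) = (if b = b' then of_nat (card B) else 0)"
    and "l \<in> L \<Longrightarrow> l' \<in> L \<Longrightarrow>
      (\<Sum>b\<in>B. unit_char ((matrix_inv R *v b) \<bullet> (l - l'))) = (if l = l' then of_nat (card B) else 0)"
proof -
  let ?N = "card B"
  let ?r = "complex_of_real (sqrt (real ?N))"
  have N: "?N > 0" using assms unfolding hadamard_triple_def by (auto simp: card_gt_0_iff)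
  have rr: "?r * ?r = of_nat ?N" by (metis of_nat_0_le_iff of_real_mult of_real_of_nat_eq real_sqrt_mult_self abs_of_nonneg)
  have r0: "?r \<noteq> 0" using N by simp
  let ?A = "\<lambda>l b. 1 / ?r * cis (2 * pi * ((matrix_inv R *v b) \<bullet> l))"
  have u: "unitary_matrix L B ?A" using assms unfolding hadamard_triple_def by blast
  {
    assume b: "b \<in> B" "b' \<in> B"
    have "(if b' = b then 1 else 0) = (\<Sum>l\<in>L. cnj (?A l b') * ?A l b)"
      using u b unfolding unitary_matrix_def by simp
    also have "\<dots> = (\<Sum>l\<in>L. 1 / of_nat ?N * unit_char ((matrix_inv R *v b - matrix_inv R *v b') \<bullet> l))"
      by (intro sum.cong refl) (simp add: cis_cnj rr[symmetric] cis_mult inner_diff_left right_diff_distrib)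
    finally have "(if b' = b then 1 else 0) = 1 / of_nat ?N * (\<Sum>l\<in>L. unit_char ((matrix_inv R *v b - matrix_inv R *v b') \<bullet> l))"
      by (simp add: sum_distrib_left)
    then show "(\<Sum>l\<in>L. unit_char ((matrix_inv R *v b - matrix_inv R *v b') \<bullet> l)) = (if b = b' then of_nat ?N else 0)"
      using N by (auto simp: field_simps split: if_splits)
  }
  {
    assume l: "l \<in> L" "l' \<in> L"
    have "(if l = l' then 1 else 0) = (\<Sum>b\<in>B. ?A l b * cnj (?A l' b))"
      using u l unfolding unitary_matrix_def by simp
    also have "\<dots> = (\<Sum>b\<in>B. 1 / of_nat ?N * unit_char ((matrix_inv R *v b) \<bullet> (l - l')))"
      by (intro sum.cong refl) (simp add: cis_cnj rr[symmetric] cis_mult inner_diff_right right_diff_distrib)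
    finally have "(if l = l' then 1 else 0) = 1 / of_nat ?N * (\<Sum>b\<in>B. unit_char ((matrix_inv R *v b) \<bullet> (l - l')))"
      by (simp add: sum_distrib_left)
    then show "(\<Sum>b\<in>B. unit_char ((matrix_inv R *v b) \<bullet> (l - l'))) = (if l = l' then of_nat ?N else 0)"
      using N by (auto simp: field_simps split: if_splits)
  }
qed

lemma B_set_0: "B_set R B 0 = {0}"
  unfolding B_set_def by auto

lemma Lambda_set_0: "Lambda_set R L 0 = {0}"
  unfolding Lambda_set_def by auto

text \<open>\<open>B_set\<close> and \<open>Lambda_set\<close> are both of this shape, so one
  recursion serves both.\<close>

lemma sums_with_choices_Suc:
  fixes f :: "nat \<Rightarrow> 'a \<Rightarrow> 'b::comm_monoid_add"
  shows "{(\<Sum>k=1..Suc n. f k (c k)) |c. \<forall>k\<in>{1..Suc n}. c k \<in> C k} =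
    (\<lambda>(x, y). x + f (Suc n) y) ` ({(\<Sum>k=1..n. f k (c k)) |c. \<forall>k\<in>{1..n}. c k \<in> C k} \<times> C (Suc n))"
proof (intro equalityI subsetI)
  fix x assume "x \<in> {(\<Sum>k=1..Suc n. f k (c k)) |c. \<forall>k\<in>{1..Suc n}. c k \<in> C k}"
  then obtain c where c: "x = (\<Sum>k=1..Suc n. f k (c k))" "\<forall>k\<in>{1..Suc n}. c k \<in> C k" by blast
  then have "x = (\<Sum>k=1..n. f k (c k)) + f (Suc n) (c (Suc n))" "\<forall>k\<in>{1..n}. c k \<in> C k" "c (Suc n) \<in> C (Suc n)"
    by auto
  then show "x \<in> (\<lambda>(x, y). x + f (Suc n) y) ` ({(\<Sum>k=1..n. f k (c k)) |c. \<forall>k\<in>{1..n}. c k \<in> C k} \<times> C (Suc n))"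
    by (intro image_eqI[of _ _ "(\<Sum>k=1..n. f k (c k), c (Suc n))"]) auto
next
  fix x assume "x \<in> (\<lambda>(x, y). x + f (Suc n) y) ` ({(\<Sum>k=1..n. f k (c k)) |c. \<forall>k\<in>{1..n}. c k \<in> C k} \<times> C (Suc n))"
  then obtain c y where c: "x = (\<Sum>k=1..n. f k (c k)) + f (Suc n) y" "\<forall>k\<in>{1..n}. c k \<in> C k" "y \<in> C (Suc n)"
    by auto
  let ?c = "c(Suc n := y)"
  have "(\<Sum>k=1..n. f k (?c k)) = (\<Sum>k=1..n. f k (c k))" by (intro sum.cong) auto
  then have "x = (\<Sum>k=1..Suc n. f k (?c k))" "\<forall>k\<in>{1..Suc n}. ?c k \<in> C k" using c by auto
  then show "x \<in> {(\<Sum>k=1..Suc n. f k (c k)) |c. \<forall>k\<in>{1..Suc n}. c k \<in> C k}" by blast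
qed

lemma B_set_Suc:
  "B_set R B (Suc n) = (\<lambda>(b, a). b + matrix_inv (R_prod R (Suc n)) *v a) ` (B_set R B n \<times> B (Suc n))"
  unfolding B_set_def by (rule sums_with_choices_Suc)

lemma Lambda_set_Suc:
  "Lambda_set R L (Suc n) = (\<lambda>(\<xi>, l). \<xi> + transpose (R_prod R n) *v l) ` (Lambda_set R L n \<times> L (Suc n))"
  unfolding Lambda_set_def
  using sums_with_choices_Suc[of "\<lambda>k l. transpose (R_prod R (k - 1)) *v l" n L] by simp

section \<open>Digit and frequency sets of a sequence of triples\<close>

locale hadamard_sequence =
  fixes R :: "nat \<Rightarrow> real ^ 'd ^ 'd" and B L :: "nat \<Rightarrow> (real ^ 'd) set"
  assumes triple: "i \<ge> 1 \<Longrightarrow> hadamard_triple (R i) (B i) (L i)"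
begin

abbreviation "P \<equiv> R_prod R"
abbreviation "\<B> \<equiv> B_set R B"
abbreviation "\<Lambda> \<equiv> Lambda_set R L"

definition "M n = (\<Prod>i=1..n. card (B i))"

lemma finite_B: "finite (B (Suc n))" and finite_L: "finite (L (Suc n))"
  and zero_B: "0 \<in> B (Suc n)" and zero_L: "0 \<in> L (Suc n)"
  and B_lattice: "B (Suc n) \<subseteq> int_lattice" and L_lattice: "L (Suc n) \<subseteq> int_lattice"
  and card_L: "card (L (Suc n)) = card (B (Suc n))"
  and int_R: "int_matrix (R (Suc n))" and invertible_R: "invertible (R (Suc n))"
  using triple[of "Suc n"] expansive_invertible unfolding hadamard_triple_def by auto

lemma card_B_pos: "card (B (Suc n)) > 0"
  using finite_B zero_B by (auto simp: card_gt_0_iff)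

lemma M_0: "M 0 = 1" and M_Suc: "M (Suc n) = M n * card (B (Suc n))"
  unfolding M_def by simp_all

lemma M_pos: "M n > 0"
  by (induction n) (auto simp: M_0 M_Suc card_B_pos)

lemma invertible_P: "invertible (P n)"
proof (induction n)
  case 0
  show ?case unfolding invertible_def by (auto intro!: exI[of _ "mat 1"])
next
  case (Suc n)
  then show ?case by (simp add: invertible_mult invertible_R)
qed

lemma P_inv_Suc: "P n *v (matrix_inv (P (Suc n)) *v b) = matrix_inv (R (Suc n)) *v b"
proof -
  have "R (Suc n) *v (P n *v (matrix_inv (P (Suc n)) *v b)) = P (Suc n) *v (matrix_inv (P (Suc n)) *v b)"
    by (simp add: matrix_vector_mul_assoc matrix_mul_assoc)
  also have "\<dots> = b" by (rule matrix_inv_vector(2)[OF invertible_P])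
  finally have "matrix_inv (R (Suc n)) *v b =
      matrix_inv (R (Suc n)) *v (R (Suc n) *v (P n *v (matrix_inv (P (Suc n)) *v b)))" by simp
  then show ?thesis by (simp only: matrix_inv_vector(1)[OF invertible_R])
qed

text \<open>Makes the pairing of an old digit sum with a new frequency digit an integer, so that it
  drops out of the phase.\<close>

lemma P_B_set_lattice: "b \<in> \<B> n \<Longrightarrow> P n *v b \<in> int_lattice"
proof (induction n arbitrary: b)
  case 0
  then show ?case by (simp add: B_set_0 int_lattice_zero)
next
  case (Suc n)
  then obtain b' a where b: "b = b' + matrix_inv (P (Suc n)) *v a" "b' \<in> \<B> n" "a \<in> B (Suc n)"
    unfolding B_set_Suc by auto
  have "P (Suc n) *v b = R (Suc n) *v (P n *v b') + a"
    unfolding b(1) matrix_vector_right_distrib matrix_inv_vector(2)[OF invertible_P]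
    by (simp add: matrix_vector_mul_assoc)
  then show ?case
    using Suc.IH[OF b(2)] b(3) B_lattice[of n] int_R[of n] by (auto intro!: int_lattice_add int_matrix_int_lattice)
qed

lemma B_set_zero: "0 \<in> \<B> n"
proof (induction n)
  case (Suc n)
  then show ?case unfolding B_set_Suc using zero_B[of n] by (force intro!: image_eqI[of _ _ "(0, 0)"])
qed (simp add: B_set_0)

lemma Lambda_set_mono_Suc: "\<Lambda> n \<subseteq> \<Lambda> (Suc n)"
proof
  fix x assume "x \<in> \<Lambda> n"
  then show "x \<in> \<Lambda> (Suc n)"
    unfolding Lambda_set_Suc using zero_L[of n] by (force intro!: image_eqI[of _ _ "(x, 0)"])
qed

lemma Lambda_set_mono: "m \<le> n \<Longrightarrow> \<Lambda> m \<subseteq> \<Lambda> n"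
  by (rule lift_Suc_mono_le[of \<Lambda>]) (rule Lambda_set_mono_Suc)

text \<open>Of the four terms of the inner product, \<open>(P n *v b) \<bullet> l\<close> is an
  integer and disappears. The old phase, the phase of the new Hadamard matrix and a mixed twist
  remain: the character matrix of level n + 1 is a twisted Kronecker product.\<close>

lemma unit_char_inner_Suc:
  assumes "P n *v b \<in> int_lattice" "l \<in> int_lattice"
  shows "unit_char ((\<xi> + transpose (P n) *v l) \<bullet> (b + matrix_inv (P (Suc n)) *v a)) =
    unit_char (\<xi> \<bullet> b) * unit_char (\<xi> \<bullet> (matrix_inv (P (Suc n)) *v a)) * unit_char ((matrix_inv (R (Suc n)) *v a) \<bullet> l)"
proof -
  have tr: "(transpose (P n) *v l) \<bullet> x = (P n *v x) \<bullet> l" for x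
    by (metis dot_lmul_matrix inner_commute transpose_matrix_vector)
  have "(\<xi> + transpose (P n) *v l) \<bullet> (b + matrix_inv (P (Suc n)) *v a) =
     \<xi> \<bullet> b + \<xi> \<bullet> (matrix_inv (P (Suc n)) *v a) + (matrix_inv (R (Suc n)) *v a) \<bullet> l + (P n *v b) \<bullet> l"
    unfolding inner_add_left inner_add_right tr P_inv_Suc by simp
  then show ?thesis
    using unit_char_Ints[OF int_lattice_inner[OF assms]] by (simp only: unit_char_add mult_1_right)
qed

text \<open>Everything goes into one induction because the injectivity of the sum maps, and with it
  the cardinalities, is itself a consequence of the orthogonality relations, which are therefore
  first proved for pairs of an old point and a new digit.\<close>

lemma unit_char_sums:
  "finite (\<B> n) \<and> finite (\<Lambda> n) \<and> card (\<B> n) = M n \<and> card (\<Lambda> n) = M n \<and>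
   (\<forall>b\<in>\<B> n. \<forall>b'\<in>\<B> n. (\<Sum>\<xi>\<in>\<Lambda> n. unit_char (\<xi> \<bullet> (b - b'))) = (if b = b' then of_nat (M n) else 0)) \<and>
   (\<forall>\<xi>\<in>\<Lambda> n. \<forall>\<xi>'\<in>\<Lambda> n. (\<Sum>b\<in>\<B> n. unit_char ((\<xi> - \<xi>') \<bullet> b)) = (if \<xi> = \<xi>' then of_nat (M n) else 0))"
proof (induction n)
  case 0
  then show ?case by (simp add: B_set_0 Lambda_set_0 M_0)
next
  case (Suc n)
  let ?Pi = "matrix_inv (P (Suc n))" and ?Ri = "matrix_inv (R (Suc n))"
  define \<beta> where "\<beta> = (\<lambda>(b, a). b + ?Pi *v a)"
  define \<gamma> where "\<gamma> = (\<lambda>(\<xi>, l). \<xi> + transpose (P n) *v l)"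
  let ?X = "\<B> n \<times> B (Suc n)" and ?Y = "\<Lambda> n \<times> L (Suc n)"
  have im: "\<B> (Suc n) = \<beta> ` ?X" "\<Lambda> (Suc n) = \<gamma> ` ?Y"
    unfolding \<beta>_def \<gamma>_def by (rule B_set_Suc, rule Lambda_set_Suc)
  have fin: "finite ?X" "finite ?Y" using Suc finite_B finite_L by auto
  have cX: "card ?X = M (Suc n)" "card ?Y = M (Suc n)" using Suc by (auto simp: card_cartesian_product M_Suc card_L)
  \<comment> \<open>Summing over l first leaves only a = a'. Then the twist is 1 and the induction
    hypothesis applies to the sum over \<xi>.\<close>
  have col: "(\<Sum>y\<in>?Y. unit_char (\<gamma> y \<bullet> (\<beta> x - \<beta> x'))) = (if x = x' then of_nat (M (Suc n)) else 0)"
    if "x \<in> ?X" "x' \<in> ?X" for x x'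
  proof -
    obtain b a b' a' where x: "x = (b, a)" "x' = (b', a')" "b \<in> \<B> n" "b' \<in> \<B> n" "a \<in> B (Suc n)" "a' \<in> B (Suc n)"
      using \<open>x \<in> ?X\<close> \<open>x' \<in> ?X\<close> by (cases x; cases x') auto
    have lat: "P n *v (b - b') \<in> int_lattice"
      unfolding matrix_vector_mult_diff_distrib using x by (intro int_lattice_diff P_B_set_lattice)
    have \<beta>: "\<beta> x - \<beta> x' = (b - b') + ?Pi *v (a - a')"
      unfolding \<beta>_def x by (simp add: matrix_vector_mult_diff_distrib)
    have "(\<Sum>y\<in>?Y. unit_char (\<gamma> y \<bullet> (\<beta> x - \<beta> x'))) =
      (\<Sum>\<xi>\<in>\<Lambda> n. \<Sum>l\<in>L (Suc n). unit_char (\<gamma> (\<xi>, l) \<bullet> (\<beta> x - \<beta> x')))"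
      unfolding sum.cartesian_product by (intro sum.cong refl) auto
    also have "\<dots> = (\<Sum>\<xi>\<in>\<Lambda> n. \<Sum>l\<in>L (Suc n). unit_char (\<xi> \<bullet> (b - b')) * unit_char (\<xi> \<bullet> (?Pi *v (a - a'))) *
        unit_char ((?Ri *v a - ?Ri *v a') \<bullet> l))"
      unfolding \<beta> \<gamma>_def prod.case matrix_vector_mult_diff_distrib[symmetric]
      using L_lattice[of n] lat by (intro sum.cong refl unit_char_inner_Suc) auto
    also have "\<dots> = (\<Sum>\<xi>\<in>\<Lambda> n. unit_char (\<xi> \<bullet> (b - b')) * unit_char (\<xi> \<bullet> (?Pi *v (a - a'))) *
        (if a = a' then of_nat (card (B (Suc n))) else 0))"
      unfolding sum_distrib_left[symmetric] hadamard_triple_sums(1)[OF triple[of "Suc n", simplified] x(5,6)] ..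
    also have "\<dots> = (if a = a' then (\<Sum>\<xi>\<in>\<Lambda> n. unit_char (\<xi> \<bullet> (b - b'))) * of_nat (card (B (Suc n))) else 0)"
      by (simp add: sum_distrib_right)
    also have "\<dots> = (if x = x' then of_nat (M (Suc n)) else 0)"
      using Suc x by (auto simp: M_Suc)
    finally show ?thesis .
  qed
  have row: "(\<Sum>x\<in>?X. unit_char ((\<gamma> y - \<gamma> y') \<bullet> \<beta> x)) = (if y = y' then of_nat (M (Suc n)) else 0)"
    if "y \<in> ?Y" "y' \<in> ?Y" for y y'
  proof -
    obtain \<xi> l \<xi>' l' where y: "y = (\<xi>, l)" "y' = (\<xi>', l')" "\<xi> \<in> \<Lambda> n" "\<xi>' \<in> \<Lambda> n" "l \<in> L (Suc n)" "l' \<in> L (Suc n)"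
      using \<open>y \<in> ?Y\<close> \<open>y' \<in> ?Y\<close> by (cases y; cases y') auto
    have lat: "l - l' \<in> int_lattice" using y L_lattice[of n] by (auto intro: int_lattice_diff)
    have \<gamma>: "\<gamma> y - \<gamma> y' = (\<xi> - \<xi>') + transpose (P n) *v (l - l')"
      unfolding \<gamma>_def y by (simp add: matrix_vector_mult_diff_distrib)
    have "(\<Sum>x\<in>?X. unit_char ((\<gamma> y - \<gamma> y') \<bullet> \<beta> x)) =
      (\<Sum>b\<in>\<B> n. \<Sum>a\<in>B (Suc n). unit_char ((\<gamma> y - \<gamma> y') \<bullet> \<beta> (b, a)))"
      unfolding sum.cartesian_product by (intro sum.cong refl) auto
    also have "\<dots> = (\<Sum>b\<in>\<B> n. \<Sum>a\<in>B (Suc n). unit_char ((\<xi> - \<xi>') \<bullet> b) * unit_char ((\<xi> - \<xi>') \<bullet> (?Pi *v a)) *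
        unit_char ((?Ri *v a) \<bullet> (l - l')))"
      unfolding \<gamma> \<beta>_def prod.case
      using lat by (intro sum.cong refl unit_char_inner_Suc P_B_set_lattice) auto
    \<comment> \<open>For rows the twist depends on a, so the sum over b has to come first: it
      leaves only \<xi> = \<xi>', where the twist is 1.\<close>
    also have "\<dots> = (\<Sum>a\<in>B (Suc n). \<Sum>b\<in>\<B> n. unit_char ((\<xi> - \<xi>') \<bullet> b) * (unit_char ((\<xi> - \<xi>') \<bullet> (?Pi *v a)) *
        unit_char ((?Ri *v a) \<bullet> (l - l'))))"
      unfolding mult.assoc by (rule sum.swap)
    also have "\<dots> = (\<Sum>a\<in>B (Suc n). (if \<xi> = \<xi>' then of_nat (M n) else 0) * (unit_char ((\<xi> - \<xi>') \<bullet> (?Pi *v a)) *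
        unit_char ((?Ri *v a) \<bullet> (l - l'))))"
      unfolding sum_distrib_right[symmetric] using Suc y by simp
    also have "\<dots> = (if \<xi> = \<xi>' then of_nat (M n) * (\<Sum>a\<in>B (Suc n). unit_char ((?Ri *v a) \<bullet> (l - l'))) else 0)"
      by (simp add: sum_distrib_left)
    also have "\<dots> = (if y = y' then of_nat (M (Suc n)) else 0)"
      unfolding hadamard_triple_sums(2)[OF triple[of "Suc n", simplified] y(5,6)]
      using y by (auto simp: M_Suc)
    finally show ?thesis .
  qed
  have M0: "M (Suc n) \<noteq> 0" using M_pos[of "Suc n"] by simp
  \<comment> \<open>A collision of distinct pairs would turn the character sum into a sum of
    \<open>M (Suc n)\<close> ones, while orthogonality makes it 0.\<close>
  have inj\<beta>: "inj_on \<beta> ?X"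
  proof (rule inj_onI)
    fix x x' assume x: "x \<in> ?X" "x' \<in> ?X" "\<beta> x = \<beta> x'"
    show "x = x'" using col[OF x(1,2)] x(3) M0 cX(2) by (simp split: if_splits)
  qed
  have inj\<gamma>: "inj_on \<gamma> ?Y"
  proof (rule inj_onI)
    fix x x' assume x: "x \<in> ?Y" "x' \<in> ?Y" "\<gamma> x = \<gamma> x'"
    show "x = x'" using row[OF x(1,2)] x(3) M0 cX(1) by (simp split: if_splits)
  qed
  have "(\<Sum>\<xi>\<in>\<Lambda> (Suc n). unit_char (\<xi> \<bullet> (\<beta> x - \<beta> x'))) = (if \<beta> x = \<beta> x' then of_nat (M (Suc n)) else 0)"
    if "x \<in> ?X" "x' \<in> ?X" for x x'
    unfolding im sum.reindex[OF inj\<gamma>] comp_def inj_on_eq_iff[OF inj\<beta> that] by (rule col[OF that])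
  then have col': "\<forall>b\<in>\<B> (Suc n). \<forall>b'\<in>\<B> (Suc n).
      (\<Sum>\<xi>\<in>\<Lambda> (Suc n). unit_char (\<xi> \<bullet> (b - b'))) = (if b = b' then of_nat (M (Suc n)) else 0)"
    unfolding im(1) by blast
  have "(\<Sum>b\<in>\<B> (Suc n). unit_char ((\<gamma> y - \<gamma> y') \<bullet> b)) = (if \<gamma> y = \<gamma> y' then of_nat (M (Suc n)) else 0)"
    if "y \<in> ?Y" "y' \<in> ?Y" for y y'
    unfolding im sum.reindex[OF inj\<beta>] comp_def inj_on_eq_iff[OF inj\<gamma> that] by (rule row[OF that])
  then have row': "\<forall>\<xi>\<in>\<Lambda> (Suc n). \<forall>\<xi>'\<in>\<Lambda> (Suc n).
      (\<Sum>b\<in>\<B> (Suc n). unit_char ((\<xi> - \<xi>') \<bullet> b)) = (if \<xi> = \<xi>' then of_nat (M (Suc n)) else 0)"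
    unfolding im(2) by blast
  have "card (\<B> (Suc n)) = M (Suc n)" "card (\<Lambda> (Suc n)) = M (Suc n)"
    unfolding im card_image[OF inj\<beta>] card_image[OF inj\<gamma>] by (rule cX)+
  moreover have "finite (\<B> (Suc n))" "finite (\<Lambda> (Suc n))" unfolding im using fin by auto
  ultimately show ?case using col' row' by blast
qed

lemma finite_B_set: "finite (\<B> n)" and finite_Lambda_set: "finite (\<Lambda> n)"
  and card_B_set: "card (\<B> n) = M n" and card_Lambda_set: "card (\<Lambda> n) = M n"
  and B_set_char_sum: "b \<in> \<B> n \<Longrightarrow> b' \<in> \<B> n \<Longrightarrow>
    (\<Sum>\<xi>\<in>\<Lambda> n. unit_char (\<xi> \<bullet> (b - b'))) = (if b = b' then of_nat (M n) else 0)"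
  and Lambda_set_char_sum: "\<xi> \<in> \<Lambda> n \<Longrightarrow> \<xi>' \<in> \<Lambda> n \<Longrightarrow>
    (\<Sum>b\<in>\<B> n. unit_char ((\<xi> - \<xi>') \<bullet> b)) = (if \<xi> = \<xi>' then of_nat (M n) else 0)"
  using unit_char_sums[of n] by blast+

end

section \<open>Decomposition of the limit measure\<close>

context hadamard_sequence
begin

lemma factor_eq: "factor R B (Suc k) = dirac_average ((\<lambda>b. matrix_inv (P (Suc k)) *v b) ` B (Suc k))"
  unfolding factor_def ..

lemma factor_prob: "prob_space (factor R B (Suc k))" and factor_sets: "sets (factor R B (Suc k)) = sets borel"
  unfolding factor_eq using finite_B[of k] zero_B[of k] by (auto intro!: prob_space_dirac_average)

lemma inj_P_inv: "inj_on (\<lambda>b. matrix_inv (P n) *v b) X"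
  by (rule inj_on_inverseI[where g = "\<lambda>b. P n *v b"]) (rule matrix_inv_vector(2)[OF invertible_P])

text \<open>Distinct digit strings have distinct sums, so convolving uniform measures creates no
  multiplicities. The injectivity is read off from the cardinality
  \<open>card_B_set\<close>.\<close>

lemma finite_convolution_factor:
  "finite_convolution (\<lambda>k. factor R B (Suc k)) n = dirac_average (\<B> n)"
proof (induction n)
  case 0
  show ?case
  proof (rule measure_eqI_bounded_continuous)
    have "prob_space (return borel (0 :: real ^ 'd))" "prob_space (dirac_average {0 :: real ^ 'd})"
      by (auto intro: prob_space_return prob_space_dirac_average)
    then show "finite_measure (finite_convolution (\<lambda>k. factor R B (Suc k)) 0)" "finite_measure (dirac_average (\<B> 0))"
      by (auto simp: B_set_0 intro: prob_space.axioms(1))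
    fix f :: "real ^ 'd \<Rightarrow> real" assume f: "continuous_on UNIV f"
    then have "f \<in> borel_measurable borel" by (rule borel_measurable_continuous_onI)
    then show "(\<integral>x. f x \<partial>finite_convolution (\<lambda>k. factor R B (Suc k)) 0) = (\<integral>x. f x \<partial>dirac_average (\<B> 0))"
      by (simp add: B_set_0 integral_dirac_average integral_return)
  qed auto
next
  case (Suc n)
  define A where "A = (\<lambda>b. matrix_inv (P (Suc n)) *v b) ` B (Suc n)"
  have A: "finite A" "A \<noteq> {}" "card A = card (B (Suc n))"
    unfolding A_def using finite_B[of n] zero_B[of n] card_image[OF inj_P_inv] by (auto simp del: R_prod.simps)
  have Bn: "finite (\<B> n)" "\<B> n \<noteq> {}" "finite (\<B> (Suc n))" "\<B> (Suc n) \<noteq> {}"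
    using finite_B_set B_set_zero by auto
  let ?g = "\<lambda>(b, a). b + a"
  have im: "\<B> (Suc n) = ?g ` (\<B> n \<times> A)"
    unfolding B_set_Suc A_def by (force simp: image_iff)
  have inj: "inj_on ?g (\<B> n \<times> A)"
  proof (rule eq_card_imp_inj_on)
    show "finite (\<B> n \<times> A)" using A Bn by simp
    show "card (?g ` (\<B> n \<times> A)) = card (\<B> n \<times> A)"
      unfolding im[symmetric] by (simp add: card_B_set card_cartesian_product A(3) M_Suc)
  qed
  note pA = prob_space_dirac_average[OF A(1,2)] and pB = prob_space_dirac_average[OF Bn(1,2)]
  have "(dirac_average (\<B> n) \<star> dirac_average A) = dirac_average (\<B> (Suc n))"
  proof (rule measure_eqI_bounded_continuous)
    show "finite_measure (dirac_average (\<B> n) \<star> dirac_average A)"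
      using prob_space_convolution[OF pB pA] by (simp add: prob_space.axioms(1))
    show "finite_measure (dirac_average (\<B> (Suc n)))"
      using prob_space_dirac_average[OF Bn(3,4)] by (rule prob_space.axioms(1))
    fix f :: "real ^ 'd \<Rightarrow> real" assume f: "continuous_on UNIV f" "bounded (range f)"
    then have [measurable]: "f \<in> borel_measurable borel" by (intro borel_measurable_continuous_onI)
    have "(\<integral>x. f x \<partial>(dirac_average (\<B> n) \<star> dirac_average A)) =
        (\<integral>x. (\<integral>y. f (x + y) \<partial>dirac_average A) \<partial>dirac_average (\<B> n))"
      by (rule integral_convolution[OF pB pA]) (use f in auto)
    also have "\<dots> = (\<integral>x. (\<Sum>a\<in>A. f (x + a)) / real (card A) \<partial>dirac_average (\<B> n))"
      by (intro Bochner_Integration.integral_cong refl integral_dirac_average A) measurable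
    also have "\<dots> = (\<Sum>b\<in>\<B> n. (\<Sum>a\<in>A. f (b + a)) / real (card A)) / real (card (\<B> n))"
      by (intro integral_dirac_average Bn) measurable
    also have "\<dots> = (\<Sum>x\<in>\<B> n \<times> A. f (?g x)) / real (card (\<B> (Suc n)))"
      unfolding card_B_set M_Suc A(3) sum_divide_distrib[symmetric] sum.cartesian_product
      by (simp add: case_prod_unfold mult.commute)
    also have "\<dots> = (\<Sum>x\<in>\<B> (Suc n). f x) / real (card (\<B> (Suc n)))"
      unfolding im sum.reindex[OF inj] by (simp add: comp_def)
    also have "\<dots> = (\<integral>x. f x \<partial>dirac_average (\<B> (Suc n)))"
      by (rule integral_dirac_average[symmetric, OF Bn(3)]) measurable
    finally show "(\<integral>x. f x \<partial>(dirac_average (\<B> n) \<star> dirac_average A)) = (\<integral>x. f x \<partial>dirac_average (\<B> (Suc n)))" .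
  qed auto
  then show ?case using Suc by (simp add: factor_eq A_def)
qed

definition "digit_bound k = Max ((\<lambda>b. norm (matrix_inv (P (Suc k)) *v b)) ` B (Suc k))"

lemma digit_bound: "b \<in> B (Suc k) \<Longrightarrow> norm (matrix_inv (P (Suc k)) *v b) \<le> digit_bound k"
  unfolding digit_bound_def using finite_B by (intro Max_ge) auto

text \<open>Positions outside Q receive the digit 0. A bound on all \<open>B_set\<close> is thereby
  a bound on all finite subsums, which is what absolute summability needs.\<close>

lemma subset_sum_in_B_set:
  assumes \<beta>: "\<And>k. \<beta> k \<in> B (Suc k)" and Q: "Q \<subseteq> {..<n}"
  shows "(\<Sum>k\<in>Q. matrix_inv (P (Suc k)) *v \<beta> k) \<in> \<B> n"
proof -
  define b where "b i = (if i - 1 \<in> Q then \<beta> (i - 1) else 0)" for i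
  have "(\<Sum>i=1..n. matrix_inv (P i) *v b i) = (\<Sum>k<n. matrix_inv (P (Suc k)) *v b (Suc k))"
    using sum.atLeast1_atMost_eq[of "\<lambda>i. matrix_inv (P i) *v b i" n] by simp
  also have "\<dots> = (\<Sum>k\<in>Q. matrix_inv (P (Suc k)) *v \<beta> k)"
    using Q by (intro sum.mono_neutral_cong_right) (auto simp: b_def)
  finally have "(\<Sum>k\<in>Q. matrix_inv (P (Suc k)) *v \<beta> k) = (\<Sum>i=1..n. matrix_inv (P i) *v b i)" ..
  moreover have "b i \<in> B i" if "i \<in> {1..n}" for i
    using that \<beta>[of "i - 1"] zero_B[of "i - 1"] unfolding b_def by auto
  ultimately show ?thesis unfolding B_set_def by blast
qed

end

section \<open>Tails and disintegration of the limit\<close>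

locale compact_hadamard_sequence = hadamard_sequence +
  fixes \<mu>
  assumes conv: "is_infinite_convolution (\<lambda>k. factor R B (Suc k)) \<mu>"
    and compact_support: "compact (measure_support \<mu>)"
begin

abbreviation "\<tau> \<equiv> tail_measure R B"

lemma \<mu>_prob: "prob_space \<mu>" and \<mu>_sets: "sets \<mu> = sets borel"
  using conv unfolding is_infinite_convolution_def by auto

lemma B_set_bounded: obtains C where "\<And>n b. b \<in> \<B> n \<Longrightarrow> norm b \<le> C"
proof -
  obtain C where C: "\<And>n S b. finite S \<Longrightarrow> 0 \<in> S \<Longrightarrow>
      finite_convolution (\<lambda>k. factor R B (Suc k)) n = dirac_average S \<Longrightarrow> b \<in> S \<Longrightarrow> norm b \<le> C"
    using partial_sums_bounded[OF factor_prob factor_sets conv compact_support] by blast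
  show ?thesis by (rule that) (rule C[OF finite_B_set B_set_zero finite_convolution_factor])
qed

lemma summable_digit_bound: "summable digit_bound"
proof -
  obtain C where C: "\<And>n b. b \<in> \<B> n \<Longrightarrow> norm b \<le> C" using B_set_bounded by blast
  have "\<exists>b\<in>B (Suc k). norm (matrix_inv (P (Suc k)) *v b) = digit_bound k" for k
  proof -
    have "digit_bound k \<in> (\<lambda>b. norm (matrix_inv (P (Suc k)) *v b)) ` B (Suc k)"
      unfolding digit_bound_def using finite_B[of k] zero_B[of k] by (intro Max_in) auto
    then show ?thesis by auto
  qed
  then obtain \<beta> where \<beta>: "\<And>k. \<beta> k \<in> B (Suc k)"
    "\<And>k. norm (matrix_inv (P (Suc k)) *v \<beta> k) = digit_bound k" by metis
  \<comment> \<open>With all finite subsums bounded by C, the positive and the negative terms of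
    each coordinate add up to at most C in modulus; hence twice the dimension.\<close>
  have "(\<Sum>k<n. norm (matrix_inv (P (Suc k)) *v \<beta> k)) \<le> 2 * real DIM(real ^ 'a) * C" for n
    by (rule sum_norm_allsubsets_bound) (auto simp del: R_prod.simps intro!: C subset_sum_in_B_set \<beta>(1))
  then show ?thesis unfolding \<beta>(2)
    by (rule summableI_nonneg_bounded[rotated]) (simp add: \<beta>(2)[symmetric])
qed

definition "tail_bound n = (\<Sum>k. digit_bound (k + n))"

lemma tail_bound_tendsto: "tail_bound \<longlonglongrightarrow> 0"
proof -
  have "(\<lambda>n. suminf digit_bound - sum digit_bound {..<n}) \<longlonglongrightarrow> suminf digit_bound - suminf digit_bound"
    by (intro tendsto_intros summable_LIMSEQ summable_digit_bound)
  then show ?thesis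
    unfolding tail_bound_def suminf_minus_initial_segment[OF summable_digit_bound] by simp
qed

text \<open>A limit is first constructed from independent digits; uniqueness then identifies it with
  the definite description \<open>tail_measure\<close>, so the norm bound carries over.\<close>

lemma tail_measure: "is_infinite_convolution (\<lambda>k. factor R B (n + Suc k)) (\<tau> n)"
  and tail_norm: "AE y in \<tau> n. norm y \<le> tail_bound n"
proof -
  have "\<exists>\<tau>. is_infinite_convolution
      (\<lambda>k. dirac_average ((\<lambda>b. matrix_inv (P (Suc (k + n))) *v b) ` B (Suc (k + n)))) \<tau> \<and>
      (AE y in \<tau>. norm y \<le> tail_bound n)"
    unfolding tail_bound_def
  proof (rule exists_infinite_convolution)
    show "summable (\<lambda>k. digit_bound (k + n))"
      using summable_digit_bound by (rule summable_ignore_initial_segment)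
    show "(\<lambda>b. matrix_inv (P (Suc (k + n))) *v b) ` B (Suc (k + n)) \<noteq> {}" for k
      using zero_B[of "k + n"] by blast
  qed (use finite_B digit_bound in auto)
  then obtain t where t: "is_infinite_convolution (\<lambda>k. factor R B (n + Suc k)) t" "AE y in t. norm y \<le> tail_bound n"
    unfolding factor_def by (auto simp: add.commute)
  have eq: "\<tau> n = t" unfolding tail_measure_def by (rule infinite_convolution_eqI[OF t(1)])
  show "is_infinite_convolution (\<lambda>k. factor R B (n + Suc k)) (\<tau> n)" "AE y in \<tau> n. norm y \<le> tail_bound n"
    unfolding eq by (rule t)+
qed

lemma \<tau>_prob: "prob_space (\<tau> n)" and \<tau>_sets: "sets (\<tau> n) = sets borel"
  using tail_measure unfolding is_infinite_convolution_def by auto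

lemma integrable_\<mu>:
  fixes f :: "_ \<Rightarrow> 'b::{banach, second_countable_topology}"
  shows "continuous_on UNIV f \<Longrightarrow> bounded (range f) \<Longrightarrow> integrable \<mu> f"
  by (rule integrable_bounded_continuous[OF prob_space.axioms(1)[OF \<mu>_prob] \<mu>_sets])

lemma integrable_\<tau>:
  fixes f :: "_ \<Rightarrow> 'b::{banach, second_countable_topology}"
  shows "continuous_on UNIV f \<Longrightarrow> bounded (range f) \<Longrightarrow> integrable (\<tau> n) f"
  by (rule integrable_bounded_continuous[OF prob_space.axioms(1)[OF \<tau>_prob] \<tau>_sets])

lemma disintegration_real:
  fixes f :: "_ \<Rightarrow> real"
  assumes "continuous_on UNIV f" "bounded (range f)"
  shows "(\<integral>x. f x \<partial>\<mu>) = (\<Sum>b\<in>\<B> n. \<integral>y. f (b + y) \<partial>\<tau> n) / real (M n)"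
  using infinite_convolution_disintegration[OF factor_prob factor_sets conv _ finite_B_set
      finite_convolution_factor assms, of n "\<tau> n"] tail_measure[of n]
  by (simp add: card_B_set)

lemma bounded_continuous_translate:
  fixes f :: "'x::real_normed_vector \<Rightarrow> 'y::real_normed_vector"
  assumes "continuous_on UNIV f" "bounded (range f)"
  shows "continuous_on UNIV (\<lambda>y. f (b + y))" "bounded (range (\<lambda>y. f (b + y)))"
  by (rule continuous_on_compose2[OF assms(1)], auto intro!: continuous_intros)
    (rule bounded_subset[OF assms(2)], auto)

text \<open>Weak convergence is tested with real functions, hence the passage through real and
  imaginary parts.\<close>

lemma disintegration:
  fixes f :: "_ \<Rightarrow> complex"
  assumes f: "continuous_on UNIV f" "bounded (range f)"
  shows "(\<integral>x. f x \<partial>\<mu>) = (\<Sum>b\<in>\<B> n. \<integral>y. f (b + y) \<partial>\<tau> n) / of_nat (M n)"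
proof -
  obtain K where K: "\<And>x. cmod (f x) \<le> K" using f(2) unfolding bounded_iff by auto
  have bd: "bounded (range (\<lambda>x. Re (f x)))" "bounded (range (\<lambda>x. Im (f x)))"
    using order_trans[OF abs_Re_le_cmod K] order_trans[OF abs_Im_le_cmod K]
    by (auto intro!: boundedI[where B=K])
  have cont: "continuous_on UNIV (\<lambda>x. Re (f x))" "continuous_on UNIV (\<lambda>x. Im (f x))"
    using f(1) by (auto intro!: continuous_intros)
  have i1: "integrable \<mu> f" using f by (rule integrable_\<mu>)
  have i2: "integrable (\<tau> n) (\<lambda>y. f (b + y))" for b
    using bounded_continuous_translate[OF f] by (rule integrable_\<tau>)
  show ?thesis
  proof (rule complex_eqI)
    show "Re (\<integral>x. f x \<partial>\<mu>) = Re ((\<Sum>b\<in>\<B> n. \<integral>y. f (b + y) \<partial>\<tau> n) / of_nat (M n))"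
      using disintegration_real[OF cont(1) bd(1), of n] i1 i2
      by simp
    show "Im (\<integral>x. f x \<partial>\<mu>) = Im ((\<Sum>b\<in>\<B> n. \<integral>y. f (b + y) \<partial>\<tau> n) / of_nat (M n))"
      using disintegration_real[OF cont(2) bd(2), of n] i1 i2
      by simp
  qed
qed

abbreviation "wave \<equiv> \<lambda>\<xi> x. unit_char (\<xi> \<bullet> x)"

lemma wave_continuous: "continuous_on UNIV (wave \<xi>)" and wave_bounded: "bounded (range (wave \<xi>))"
  by (auto intro!: continuous_intros boundedI[where B=1])

lemma wave_add: "wave \<xi> (x + y) = wave \<xi> x * wave \<xi> y"
  unfolding inner_add_right by (rule unit_char_add)

text \<open>The basis functions and \<open>fourier\<close> use opposite signs in the exponent,
  whence the conjugate.\<close>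

lemma integral_wave: "(\<integral>y. wave \<xi> y \<partial>\<tau> n) = cnj (fourier (\<tau> n) \<xi>)"
proof -
  have "cnj (fourier (\<tau> n) \<xi>) = (\<integral>y. cnj (cis (- 2 * pi * (\<xi> \<bullet> y))) \<partial>\<tau> n)"
    unfolding fourier_def by (rule Bochner_Integration.integral_cnj[symmetric])
  also have "\<dots> = (\<integral>y. wave \<xi> y \<partial>\<tau> n)"
    by (rule Bochner_Integration.integral_cong) (simp_all add: cis_cnj)
  finally show ?thesis ..
qed

text \<open>At level n the integral factors into a character sum over \<open>\<B> n\<close> and a
  tail integral. The sum is 0 for distinct frequencies; for equal ones the tail integral is the
  total mass 1.\<close>

lemma integral_wave_product:
  assumes "\<xi> \<in> \<Lambda> n" "\<xi>' \<in> \<Lambda> n"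
  shows "(\<integral>x. wave \<xi> x * cnj (wave \<xi>' x) \<partial>\<mu>) = (if \<xi> = \<xi>' then 1 else 0)"
proof -
  have "(\<integral>x. wave \<xi> x * cnj (wave \<xi>' x) \<partial>\<mu>) = (\<integral>x. wave (\<xi> - \<xi>') x \<partial>\<mu>)"
    by (simp add: cis_cnj cis_mult inner_diff_left right_diff_distrib)
  also have "\<dots> = (\<Sum>b\<in>\<B> n. \<integral>y. wave (\<xi> - \<xi>') (b + y) \<partial>\<tau> n) / of_nat (M n)"
    by (rule disintegration[OF wave_continuous wave_bounded])
  also have "\<dots> = (\<Sum>b\<in>\<B> n. wave (\<xi> - \<xi>') b) * (\<integral>y. wave (\<xi> - \<xi>') y \<partial>\<tau> n) / of_nat (M n)"
    unfolding wave_add by (simp add: sum_distrib_right)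
  also have "\<dots> = (if \<xi> = \<xi>' then 1 else 0)"
    unfolding Lambda_set_char_sum[OF assms]
    using M_pos[of n] prob_space.prob_space[OF \<tau>_prob[of n]] by simp
  finally show ?thesis .
qed

end

section \<open>Completeness of the exponentials\<close>

lemma cmod_diff_sq: "(cmod (x - y))\<^sup>2 = (cmod x)\<^sup>2 - 2 * Re (cnj x * y) + (cmod y)\<^sup>2"
  unfolding cmod_power2 by (simp add: power2_eq_square algebra_simps)

context compact_hadamard_sequence
begin

definition trig :: "(real ^ 'a) set \<Rightarrow> (real ^ 'a \<Rightarrow> complex) \<Rightarrow> real ^ 'a \<Rightarrow> complex" where
  "trig F \<alpha> x = (\<Sum>\<xi>\<in>F. \<alpha> \<xi> * wave \<xi> x)"

lemma trig_continuous: "continuous_on UNIV (trig F \<alpha>)"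
  unfolding trig_def by (intro continuous_intros)

lemma trig_bounded: "bounded (range (trig F \<alpha>))"
proof (rule boundedI)
  fix z assume "z \<in> range (trig F \<alpha>)"
  then obtain x where "z = trig F \<alpha> x" by blast
  then show "norm z \<le> (\<Sum>\<xi>\<in>F. cmod (\<alpha> \<xi>))"
    unfolding trig_def by (auto intro!: order_trans[OF norm_sum] sum_mono simp: norm_mult)
qed

lemma trig_norm_sq:
  assumes "F = \<Lambda> n"
  shows "(\<integral>x. (cmod (trig F \<alpha> x))\<^sup>2 \<partial>\<mu>) = (\<Sum>\<xi>\<in>F. (cmod (\<alpha> \<xi>))\<^sup>2)"
proof -
  have fin: "finite F" using assms finite_Lambda_set by simp
  have int: "integrable \<mu> (\<lambda>x. \<alpha> \<xi> * cnj (\<alpha> \<xi>') * (wave \<xi> x * cnj (wave \<xi>' x)))" for \<xi> \<xi>'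
    by (intro integrable_\<mu>) (auto intro!: continuous_intros boundedI[where B="cmod (\<alpha> \<xi>) * cmod (\<alpha> \<xi>')"] simp: norm_mult)
  have "complex_of_real (\<integral>x. (cmod (trig F \<alpha> x))\<^sup>2 \<partial>\<mu>) = (\<integral>x. trig F \<alpha> x * cnj (trig F \<alpha> x) \<partial>\<mu>)"
    unfolding complex_norm_square[symmetric] by (rule integral_complex_of_real[symmetric])
  also have "\<dots> = (\<integral>x. (\<Sum>\<xi>\<in>F. \<Sum>\<xi>'\<in>F. \<alpha> \<xi> * cnj (\<alpha> \<xi>') * (wave \<xi> x * cnj (wave \<xi>' x))) \<partial>\<mu>)"
    unfolding trig_def cnj_sum sum_product
    by (intro Bochner_Integration.integral_cong refl sum.cong) (simp add: mult_ac)
  also have "\<dots> = (\<Sum>\<xi>\<in>F. \<Sum>\<xi>'\<in>F. \<integral>x. \<alpha> \<xi> * cnj (\<alpha> \<xi>') * (wave \<xi> x * cnj (wave \<xi>' x)) \<partial>\<mu>)"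
    by (subst Bochner_Integration.integral_sum, intro Bochner_Integration.integrable_sum int)
      (intro sum.cong refl Bochner_Integration.integral_sum int)
  also have "\<dots> = (\<Sum>\<xi>\<in>F. \<Sum>\<xi>'\<in>F. \<alpha> \<xi> * cnj (\<alpha> \<xi>') * (if \<xi> = \<xi>' then 1 else 0))"
    using assms by (intro sum.cong refl) (simp only: integral_mult_right_zero integral_wave_product)
  also have "\<dots> = (\<Sum>\<xi>\<in>F. \<alpha> \<xi> * cnj (\<alpha> \<xi>))"
    using fin by (simp add: if_distrib cong: if_cong)
  also have "\<dots> = complex_of_real (\<Sum>\<xi>\<in>F. (cmod (\<alpha> \<xi>))\<^sup>2)"
    unfolding complex_of_real_sum_cmod_sq by (simp add: mult.commute)
  finally show ?thesis unfolding of_real_eq_iff .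
qed

text \<open>\<open>c\<close> stands for the step function with value \<open>c b\<close> on the translate by \<open>b\<close>, regarded as a function on
  the product of \<open>\<B> n\<close> and \<open>\<tau> n\<close> instead of \<open>\<mu>\<close>; \<open>step_coeff\<close> are its Fourier coefficients.\<close>
definition "step_coeff n c \<xi> = (\<Sum>b\<in>\<B> n. c b * cnj (wave \<xi> b)) / of_nat (M n) * fourier (\<tau> n) \<xi>"

lemma cmod_F_matrix_sum:
  "(cmod (\<Sum>b\<in>\<B> n. F_matrix R B n \<xi> b * c b))\<^sup>2 =
    (cmod (fourier (\<tau> n) \<xi>))\<^sup>2 / real (M n) * (cmod (\<Sum>b\<in>\<B> n. c b * cnj (wave \<xi> b)))\<^sup>2"
proof -
  have "(\<Sum>b\<in>\<B> n. F_matrix R B n \<xi> b * c b) =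
      complex_of_real (cmod (fourier (\<tau> n) \<xi>)) / complex_of_real (sqrt (real (M n))) * (\<Sum>b\<in>\<B> n. c b * cnj (wave \<xi> b))"
    unfolding F_matrix_def M_def[symmetric] sum_distrib_left
    by (intro sum.cong refl) (simp add: cis_cnj inner_commute mult_ac)
  then show ?thesis
    by (simp add: norm_mult norm_divide power_mult_distrib power_divide)
qed

text \<open>\<open>F_matrix\<close> contains the modulus of the tail transform, the Fourier
  coefficients the transform itself. The phase is common to a whole row, so the moduli agree up to
  normalisation.\<close>

lemma cmod_step_coeff:
  "(cmod (step_coeff n c \<xi>))\<^sup>2 = (cmod (\<Sum>b\<in>\<B> n. F_matrix R B n \<xi> b * c b))\<^sup>2 / real (M n)"
  unfolding step_coeff_def cmod_F_matrix_sum
  by (simp add: norm_mult norm_divide power_mult_distrib power_divide power2_eq_square)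

text \<open>Pythagoras for the projection onto the exponentials of \<open>\<Lambda> n\<close>, which
  stay orthonormal as functions of (b, y) through b + y because integrals against \<mu>
  disintegrate. The cross term and the squared norm of the projection are both the sum S of the
  squared coefficients.\<close>

lemma step_residual:
  defines "h \<equiv> \<lambda>n c. trig (\<Lambda> n) (step_coeff n c)"
  shows "(\<Sum>b\<in>\<B> n. \<integral>y. (cmod (c b - h n c (b + y)))\<^sup>2 \<partial>\<tau> n) / real (M n) =
    ((\<Sum>b\<in>\<B> n. (cmod (c b))\<^sup>2) - (\<Sum>\<xi>\<in>\<Lambda> n. (cmod (\<Sum>b\<in>\<B> n. F_matrix R B n \<xi> b * c b))\<^sup>2)) / real (M n)"
proof -
  let ?\<alpha> = "step_coeff n c"
  let ?h = "trig (\<Lambda> n) ?\<alpha>"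
  interpret T: prob_space "\<tau> n" by (rule \<tau>_prob)
  define S where "S = (\<Sum>\<xi>\<in>\<Lambda> n. (cmod (?\<alpha> \<xi>))\<^sup>2)"
  note hc = trig_continuous[of "\<Lambda> n" ?\<alpha>] and hb = trig_bounded[of "\<Lambda> n" ?\<alpha>]
  have ih: "integrable (\<tau> n) (\<lambda>y. ?h (b + y))" for b
    using bounded_continuous_translate[OF hc hb] by (rule integrable_\<tau>)
  have h2: "continuous_on UNIV (\<lambda>x. (cmod (?h x))\<^sup>2)" "bounded (range (\<lambda>x. (cmod (?h x))\<^sup>2))"
    using hc bounded_range_sq[OF hb] by (auto intro!: continuous_intros)
  have ih2: "integrable (\<tau> n) (\<lambda>y. (cmod (?h (b + y)))\<^sup>2)" for b
    using bounded_continuous_translate[OF h2] by (rule integrable_\<tau>)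
  have expand: "(\<integral>y. (cmod (c b - ?h (b + y)))\<^sup>2 \<partial>\<tau> n) =
      (cmod (c b))\<^sup>2 - 2 * Re (cnj (c b) * (\<integral>y. ?h (b + y) \<partial>\<tau> n)) + (\<integral>y. (cmod (?h (b + y)))\<^sup>2 \<partial>\<tau> n)" for b
  proof -
    have "(\<integral>y. (cmod (c b - ?h (b + y)))\<^sup>2 \<partial>\<tau> n) =
        (\<integral>y. (cmod (c b))\<^sup>2 - 2 * Re (cnj (c b) * ?h (b + y)) + (cmod (?h (b + y)))\<^sup>2 \<partial>\<tau> n)"
      unfolding cmod_diff_sq ..
    also have "\<dots> = (cmod (c b))\<^sup>2 - 2 * Re (\<integral>y. cnj (c b) * ?h (b + y) \<partial>\<tau> n) + (\<integral>y. (cmod (?h (b + y)))\<^sup>2 \<partial>\<tau> n)"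
      using ih[of b] ih2[of b] by (simp add: T.prob_space del: times_complex.sel)
    finally show ?thesis by simp
  qed
  have inth: "(\<integral>y. ?h (b + y) \<partial>\<tau> n) = (\<Sum>\<xi>\<in>\<Lambda> n. ?\<alpha> \<xi> * wave \<xi> b * cnj (fourier (\<tau> n) \<xi>))" for b
  proof -
    have "(\<integral>y. ?h (b + y) \<partial>\<tau> n) = (\<integral>y. (\<Sum>\<xi>\<in>\<Lambda> n. ?\<alpha> \<xi> * wave \<xi> b * wave \<xi> y) \<partial>\<tau> n)"
      unfolding trig_def wave_add by (simp only: mult.assoc)
    also have "\<dots> = (\<Sum>\<xi>\<in>\<Lambda> n. \<integral>y. ?\<alpha> \<xi> * wave \<xi> b * wave \<xi> y \<partial>\<tau> n)"
      by (intro Bochner_Integration.integral_sum integrable_mult_right integrable_\<tau> wave_continuous wave_bounded)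
    also have "\<dots> = (\<Sum>\<xi>\<in>\<Lambda> n. ?\<alpha> \<xi> * wave \<xi> b * cnj (fourier (\<tau> n) \<xi>))"
      unfolding integral_mult_right_zero integral_wave ..
    finally show ?thesis .
  qed
  have "(\<Sum>b\<in>\<B> n. cnj (c b) * (\<integral>y. ?h (b + y) \<partial>\<tau> n)) / of_nat (M n) =
      (\<Sum>\<xi>\<in>\<Lambda> n. \<Sum>b\<in>\<B> n. cnj (c b) * (?\<alpha> \<xi> * wave \<xi> b * cnj (fourier (\<tau> n) \<xi>))) / of_nat (M n)"
    unfolding inth sum_distrib_left by (subst sum.swap) (rule refl)
  also have "\<dots> = (\<Sum>\<xi>\<in>\<Lambda> n. ?\<alpha> \<xi> * cnj (?\<alpha> \<xi>))"
    unfolding sum_divide_distrib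
  proof (intro sum.cong refl)
    fix \<xi>
    have c: "cnj (?\<alpha> \<xi>) = (\<Sum>b\<in>\<B> n. cnj (c b) * wave \<xi> b) / of_nat (M n) * cnj (fourier (\<tau> n) \<xi>)"
      unfolding step_coeff_def by simp
    show "(\<Sum>b\<in>\<B> n. cnj (c b) * (?\<alpha> \<xi> * wave \<xi> b * cnj (fourier (\<tau> n) \<xi>)) / of_nat (M n)) = ?\<alpha> \<xi> * cnj (?\<alpha> \<xi>)"
      unfolding c by (simp add: sum_distrib_left sum_distrib_right sum_divide_distrib mult_ac)
  qed
  also have "\<dots> = complex_of_real S"
    unfolding S_def complex_of_real_sum_cmod_sq by (simp add: mult.commute)
  finally have cross: "(\<Sum>b\<in>\<B> n. cnj (c b) * (\<integral>y. ?h (b + y) \<partial>\<tau> n)) / of_nat (M n) = complex_of_real S" .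
  have "Re ((\<Sum>b\<in>\<B> n. cnj (c b) * (\<integral>y. ?h (b + y) \<partial>\<tau> n)) / of_nat (M n)) = S"
    unfolding cross by simp
  then have cross': "(\<Sum>b\<in>\<B> n. Re (cnj (c b) * (\<integral>y. ?h (b + y) \<partial>\<tau> n))) / real (M n) = S"
    unfolding Re_divide_of_nat Re_sum .
  have sq: "(\<Sum>b\<in>\<B> n. \<integral>y. (cmod (?h (b + y)))\<^sup>2 \<partial>\<tau> n) / real (M n) = S"
    using disintegration_real[OF h2, of n] trig_norm_sq[OF refl, of n ?\<alpha>] unfolding S_def by simp
  have "(\<Sum>b\<in>\<B> n. \<integral>y. (cmod (c b - ?h (b + y)))\<^sup>2 \<partial>\<tau> n) / real (M n) =
     (\<Sum>b\<in>\<B> n. (cmod (c b))\<^sup>2) / real (M n) - 2 * S + S"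
    unfolding expand sum.distrib sum_subtractf add_divide_distrib diff_divide_distrib sq sum_distrib_left[symmetric]
    using cross' by simp
  also have "S = (\<Sum>\<xi>\<in>\<Lambda> n. (cmod (\<Sum>b\<in>\<B> n. F_matrix R B n \<xi> b * c b))\<^sup>2) / real (M n)"
    unfolding S_def cmod_step_coeff by (simp add: sum_divide_distrib)
  finally show ?thesis unfolding h_def by (simp add: diff_divide_distrib)
qed

end

section \<open>The contraction and its iteration\<close>

locale lower_bound_sequence = compact_hadamard_sequence +
  fixes s :: real
  assumes s_pos: "0 < s" and s_le: "s \<le> 1"
    and lower: "n \<ge> 1 \<Longrightarrow> s * (\<Sum>b\<in>\<B> n. (cmod (c b))\<^sup>2) \<le>
      (\<Sum>\<xi>\<in>\<Lambda> n. (cmod (\<Sum>b\<in>\<B> n. F_matrix R B n \<xi> b * c b))\<^sup>2)"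
begin

lemma contraction:
  assumes \<phi>: "continuous_on UNIV \<phi>" "bounded (range \<phi>)" and \<eta>: "\<eta> > 0"
  obtains n \<alpha> where "n \<ge> 1"
    "(\<integral>x. (cmod (\<phi> x - trig (\<Lambda> n) \<alpha> x))\<^sup>2 \<partial>\<mu>) \<le> (1 - s\<^sup>2) * (\<integral>x. (cmod (\<phi> x))\<^sup>2 \<partial>\<mu>) + \<eta>"
proof -
  \<comment> \<open>k is the second constant of Young's inequality with weight s; \<delta> makes the
    replacement of \<phi> by its values on \<open>\<B> n\<close> cost at most \<eta> / 2.\<close>
  define k where "k = 1 + 1 / s"
  have k: "k > 0" unfolding k_def using s_pos by (intro add_pos_pos) auto
  define \<delta> where "\<delta> = sqrt (\<eta> / (2 * k))"
  have \<delta>: "\<delta> > 0" "k * \<delta>\<^sup>2 = \<eta> / 2" unfolding \<delta>_def using \<eta> k by auto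
  obtain C where C: "\<And>n b. b \<in> \<B> n \<Longrightarrow> norm b \<le> C" using B_set_bounded by blast
  obtain K where K: "\<And>n. \<bar>tail_bound n\<bar> \<le> K"
    using convergent_imp_Bseq[of tail_bound] tail_bound_tendsto unfolding convergent_def Bseq_def by auto
  \<comment> \<open>For every n, each b and almost every b + y lie in this ball, so the modulus of
    continuity can be fixed before n is chosen.\<close>
  have "uniformly_continuous_on (cball 0 (C + K)) \<phi>"
    using \<phi>(1) by (intro compact_uniformly_continuous) (auto intro: continuous_on_subset)
  then obtain d where d: "d > 0" "\<And>x x'. x \<in> cball 0 (C + K) \<Longrightarrow> x' \<in> cball 0 (C + K) \<Longrightarrow>
      dist x' x < d \<Longrightarrow> dist (\<phi> x') (\<phi> x) < \<delta>"
    unfolding uniformly_continuous_on_def using \<delta>(1) by metis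
  have \<phi>2: "continuous_on UNIV (\<lambda>x. (cmod (\<phi> x))\<^sup>2)" "bounded (range (\<lambda>x. (cmod (\<phi> x))\<^sup>2))"
    using \<phi>(1) bounded_range_sq[OF \<phi>(2)] by (auto intro!: continuous_intros)
  \<comment> \<open>Weak convergence tested on the squared modulus: the mean square of the sampled
    values over \<open>\<B> n\<close>, the quantity in \<open>lower\<close>, approaches the squared
    norm of \<phi>.\<close>
  have "(\<lambda>n. \<integral>x. (cmod (\<phi> x))\<^sup>2 \<partial>finite_convolution (\<lambda>k. factor R B (Suc k)) n) \<longlonglongrightarrow> (\<integral>x. (cmod (\<phi> x))\<^sup>2 \<partial>\<mu>)"
    using conv \<phi>2 unfolding is_infinite_convolution_def converges_weakly_def by blast
  then have "(\<lambda>n. (\<Sum>b\<in>\<B> n. (cmod (\<phi> b))\<^sup>2) / real (M n)) \<longlonglongrightarrow> (\<integral>x. (cmod (\<phi> x))\<^sup>2 \<partial>\<mu>)"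
    unfolding finite_convolution_factor
    by (subst (asm) integral_dirac_average)
      (auto simp: finite_B_set card_B_set intro!: borel_measurable_continuous_onI \<phi>2)
  then have "eventually (\<lambda>n. (\<Sum>b\<in>\<B> n. (cmod (\<phi> b))\<^sup>2) / real (M n) < (\<integral>x. (cmod (\<phi> x))\<^sup>2 \<partial>\<mu>) + \<eta> / 2) sequentially"
    using \<eta> by (intro order_tendstoD(2)) auto
  moreover have "eventually (\<lambda>n. tail_bound n < d) sequentially"
    using tail_bound_tendsto d(1) by (rule order_tendstoD(2))
  moreover have "eventually (\<lambda>n. n \<ge> (1::nat)) sequentially" by (rule eventually_ge_at_top)
  ultimately have "eventually (\<lambda>n. (\<Sum>b\<in>\<B> n. (cmod (\<phi> b))\<^sup>2) / real (M n) < (\<integral>x. (cmod (\<phi> x))\<^sup>2 \<partial>\<mu>) + \<eta> / 2 \<and>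
      tail_bound n < d \<and> n \<ge> 1) sequentially" by eventually_elim auto
  then obtain n where n: "(\<Sum>b\<in>\<B> n. (cmod (\<phi> b))\<^sup>2) / real (M n) < (\<integral>x. (cmod (\<phi> x))\<^sup>2 \<partial>\<mu>) + \<eta> / 2"
    "tail_bound n < d" "n \<ge> 1"
    unfolding eventually_sequentially by blast
  define h where "h = trig (\<Lambda> n) (step_coeff n \<phi>)"
  interpret T: prob_space "\<tau> n" by (rule \<tau>_prob)
  have hc: "continuous_on UNIV h" and hb: "bounded (range h)"
    unfolding h_def by (rule trig_continuous, rule trig_bounded)
  have sq_int: "integrable (\<tau> n) (\<lambda>y. (cmod (g y))\<^sup>2)" if "continuous_on UNIV g" "bounded (range g)" for g :: "real ^ 'a \<Rightarrow> complex"
    using that by (intro integrable_\<tau> bounded_range_sq) (auto intro!: continuous_intros)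
  have piece: "(\<integral>y. (cmod (\<phi> (b + y) - h (b + y)))\<^sup>2 \<partial>\<tau> n) \<le>
      (1 + s) * (\<integral>y. (cmod (\<phi> b - h (b + y)))\<^sup>2 \<partial>\<tau> n) + \<eta> / 2" if b: "b \<in> \<B> n" for b
  proof -
    note ct = bounded_continuous_translate[OF \<phi>, of b] bounded_continuous_translate[OF hc hb, of b]
    have i1: "integrable (\<tau> n) (\<lambda>y. (cmod (\<phi> (b + y) - h (b + y)))\<^sup>2)"
      by (rule sq_int) (use ct in \<open>auto intro!: continuous_intros bounded_range_diff\<close>)
    have i2: "integrable (\<tau> n) (\<lambda>y. (cmod (\<phi> b - h (b + y)))\<^sup>2)"
      by (rule sq_int) (use ct in \<open>auto intro!: continuous_intros bounded_range_diff\<close>)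
    have "AE y in \<tau> n. (cmod (\<phi> (b + y) - h (b + y)))\<^sup>2 \<le> (1 + s) * (cmod (\<phi> b - h (b + y)))\<^sup>2 + \<eta> / 2"
      using tail_norm[of n]
    proof eventually_elim
      fix y :: "real ^ 'a" assume y: "norm y \<le> tail_bound n"
      have "norm (b + y) \<le> C + K"
        using norm_triangle_ineq[of b y] C[OF b] K[of n] y by linarith
      moreover have "norm b \<le> C + K" using C[OF b] K[of n] by linarith
      moreover have "dist (b + y) b < d" using y n(2) by (simp add: dist_norm)
      ultimately have "dist (\<phi> (b + y)) (\<phi> b) < \<delta>"
        by (intro d(2)) (simp_all only: mem_cball_0)
      then have "(cmod (\<phi> (b + y) - \<phi> b))\<^sup>2 \<le> \<delta>\<^sup>2"
        by (intro power_mono) (auto simp: dist_norm)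
      then have "k * (cmod (\<phi> (b + y) - \<phi> b))\<^sup>2 \<le> k * \<delta>\<^sup>2" using k by (intro mult_left_mono) auto
      moreover have "(cmod (\<phi> (b + y) - h (b + y)))\<^sup>2 \<le>
          (1 + s) * (cmod (\<phi> b - h (b + y)))\<^sup>2 + k * (cmod (\<phi> (b + y) - \<phi> b))\<^sup>2"
        using cmod_add_sq_le[OF s_pos, of "\<phi> b - h (b + y)" "\<phi> (b + y) - \<phi> b"] unfolding k_def by simp
      ultimately show "(cmod (\<phi> (b + y) - h (b + y)))\<^sup>2 \<le> (1 + s) * (cmod (\<phi> b - h (b + y)))\<^sup>2 + \<eta> / 2"
        using \<delta>(2) by linarith
    qed
    then have "(\<integral>y. (cmod (\<phi> (b + y) - h (b + y)))\<^sup>2 \<partial>\<tau> n) \<le>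
        (\<integral>y. (1 + s) * (cmod (\<phi> b - h (b + y)))\<^sup>2 + \<eta> / 2 \<partial>\<tau> n)"
      using i1 i2 by (intro integral_mono_AE) auto
    also have "\<dots> = (1 + s) * (\<integral>y. (cmod (\<phi> b - h (b + y)))\<^sup>2 \<partial>\<tau> n) + \<eta> / 2"
      using i2 by (simp add: T.prob_space)
    finally show ?thesis .
  qed
  have M: "real (M n) > 0" using M_pos by simp
  have "(\<integral>x. (cmod (\<phi> x - h x))\<^sup>2 \<partial>\<mu>) = (\<Sum>b\<in>\<B> n. \<integral>y. (cmod (\<phi> (b + y) - h (b + y)))\<^sup>2 \<partial>\<tau> n) / real (M n)"
    using \<phi> hc hb by (intro disintegration_real bounded_range_sq bounded_range_diff) (auto intro!: continuous_intros)
  also have "\<dots> \<le> (\<Sum>b\<in>\<B> n. (1 + s) * (\<integral>y. (cmod (\<phi> b - h (b + y)))\<^sup>2 \<partial>\<tau> n) + \<eta> / 2) / real (M n)"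
    using piece by (intro divide_right_mono sum_mono) auto
  also have "\<dots> = (1 + s) * ((\<Sum>b\<in>\<B> n. \<integral>y. (cmod (\<phi> b - h (b + y)))\<^sup>2 \<partial>\<tau> n) / real (M n)) + \<eta> / 2"
    unfolding sum.distrib sum_distrib_left[symmetric] add_divide_distrib using M by (simp add: card_B_set)
  also have "\<dots> \<le> (1 + s) * ((1 - s) * ((\<Sum>b\<in>\<B> n. (cmod (\<phi> b))\<^sup>2) / real (M n))) + \<eta> / 2"
  proof -
    have "(\<Sum>b\<in>\<B> n. \<integral>y. (cmod (\<phi> b - h (b + y)))\<^sup>2 \<partial>\<tau> n) / real (M n) \<le>
        ((\<Sum>b\<in>\<B> n. (cmod (\<phi> b))\<^sup>2) - s * (\<Sum>b\<in>\<B> n. (cmod (\<phi> b))\<^sup>2)) / real (M n)"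
      unfolding h_def step_residual using lower[OF n(3), of \<phi>] by (intro divide_right_mono) auto
    also have "\<dots> = (1 - s) * ((\<Sum>b\<in>\<B> n. (cmod (\<phi> b))\<^sup>2) / real (M n))" by (simp add: left_diff_distrib)
    finally show ?thesis using s_pos by (intro add_right_mono mult_left_mono) auto
  qed
  also have "\<dots> = (1 - s\<^sup>2) * ((\<Sum>b\<in>\<B> n. (cmod (\<phi> b))\<^sup>2) / real (M n)) + \<eta> / 2"
    unfolding mult.assoc[symmetric] by (simp add: algebra_simps power2_eq_square)
  also have "\<dots> \<le> (1 - s\<^sup>2) * ((\<integral>x. (cmod (\<phi> x))\<^sup>2 \<partial>\<mu>) + \<eta> / 2) + \<eta> / 2"
    using n(1) s_pos s_le by (intro add_right_mono mult_left_mono) (auto simp: power_le_one)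
  also have "\<dots> \<le> (1 - s\<^sup>2) * (\<integral>x. (cmod (\<phi> x))\<^sup>2 \<partial>\<mu>) + \<eta>"
  proof -
    have "(1 - s\<^sup>2) * (\<eta> / 2) \<le> 1 * (\<eta> / 2)" using \<eta> by (intro mult_right_mono) auto
    then show ?thesis by (simp add: algebra_simps)
  qed
  finally show ?thesis using that[OF n(3)] unfolding h_def by blast
qed

definition "Spec = (\<Union>n\<in>{1..}. \<Lambda> n)"

lemma trig_add:
  assumes "finite F" "finite G"
  shows "trig F \<alpha> x + trig G \<beta> x =
    trig (F \<union> G) (\<lambda>\<xi>. (if \<xi> \<in> F then \<alpha> \<xi> else 0) + (if \<xi> \<in> G then \<beta> \<xi> else 0)) x"
proof -
  have "trig F \<alpha> x = (\<Sum>\<xi>\<in>F \<union> G. (if \<xi> \<in> F then \<alpha> \<xi> else 0) * wave \<xi> x)"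
    unfolding trig_def using assms by (intro sum.mono_neutral_cong_left) auto
  moreover have "trig G \<beta> x = (\<Sum>\<xi>\<in>F \<union> G. (if \<xi> \<in> G then \<beta> \<xi> else 0) * wave \<xi> x)"
    unfolding trig_def using assms by (intro sum.mono_neutral_cong_left) auto
  ultimately show ?thesis unfolding trig_def by (simp add: sum.distrib distrib_right)
qed

text \<open>Repeating \<open>contraction\<close> on the residual drives the distance to the trigonometric polynomials to 0.\<close>
lemma continuous_approx:
  assumes \<phi>: "continuous_on UNIV \<phi>" "bounded (range \<phi>)" and e: "e > 0"
  obtains F \<alpha> where "finite F" "F \<subseteq> Spec" "(\<integral>x. (cmod (\<phi> x - trig F \<alpha> x))\<^sup>2 \<partial>\<mu>) < e"
proof -
  \<comment> \<open>Taking an infimum replaces an explicit iteration: one contraction of a nearly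
    optimal residual already undercuts a positive infimum.\<close>
  define D where "D = {(\<integral>x. (cmod (\<phi> x - trig F \<alpha> x))\<^sup>2 \<partial>\<mu>) |F \<alpha>. finite F \<and> F \<subseteq> Spec}"
  define I where "I = Inf D"
  have ne: "D \<noteq> {}" unfolding D_def by blast
  have nonneg: "0 \<le> x" if "x \<in> D" for x using that unfolding D_def by auto
  then have bdd: "bdd_below D" by (rule bdd_belowI)
  have I0: "0 \<le> I" unfolding I_def using ne nonneg by (rule cInf_greatest)
  have "I \<le> 0"
  proof (rule ccontr)
    assume "\<not> I \<le> 0"
    then have I: "I > 0" by simp
    \<comment> \<open>The contraction gains \<open>s\<^sup>2 * I = 4 * \<eta>\<close>, more than the
      two errors \<eta> from near-optimality and from the contraction itself.\<close>
    define \<eta> where "\<eta> = s\<^sup>2 * I / 4"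
    have \<eta>: "\<eta> > 0" unfolding \<eta>_def using I s_pos by simp
    have "\<exists>x\<in>D. x < I + \<eta>" using cInf_lessD[OF ne, of "I + \<eta>"] \<eta> unfolding I_def by auto
    then obtain F \<alpha> where F: "finite F" "F \<subseteq> Spec" "(\<integral>x. (cmod (\<phi> x - trig F \<alpha> x))\<^sup>2 \<partial>\<mu>) < I + \<eta>"
      unfolding D_def by blast
    have "continuous_on UNIV (\<lambda>x. \<phi> x - trig F \<alpha> x)" "bounded (range (\<lambda>x. \<phi> x - trig F \<alpha> x))"
      using \<phi> trig_continuous trig_bounded by (auto intro!: continuous_intros bounded_range_diff)
    from contraction[OF this \<eta>] obtain n \<beta> where n: "n \<ge> 1"
      "(\<integral>x. (cmod (\<phi> x - trig F \<alpha> x - trig (\<Lambda> n) \<beta> x))\<^sup>2 \<partial>\<mu>) \<le>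
        (1 - s\<^sup>2) * (\<integral>x. (cmod (\<phi> x - trig F \<alpha> x))\<^sup>2 \<partial>\<mu>) + \<eta>" by blast
    let ?\<gamma> = "\<lambda>\<xi>. (if \<xi> \<in> F then \<alpha> \<xi> else 0) + (if \<xi> \<in> \<Lambda> n then \<beta> \<xi> else 0)"
    have "(\<integral>x. (cmod (\<phi> x - trig F \<alpha> x - trig (\<Lambda> n) \<beta> x))\<^sup>2 \<partial>\<mu>) = (\<integral>x. (cmod (\<phi> x - trig (F \<union> \<Lambda> n) ?\<gamma> x))\<^sup>2 \<partial>\<mu>)"
      unfolding trig_add[OF F(1) finite_Lambda_set, symmetric] by (simp add: diff_diff_eq)
    moreover have "F \<union> \<Lambda> n \<subseteq> Spec" using F(2) n(1) unfolding Spec_def by auto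
    ultimately have "(\<integral>x. (cmod (\<phi> x - trig F \<alpha> x - trig (\<Lambda> n) \<beta> x))\<^sup>2 \<partial>\<mu>) \<in> D"
      unfolding D_def using F(1) finite_Lambda_set[of n] by blast
    then have "I \<le> (\<integral>x. (cmod (\<phi> x - trig F \<alpha> x - trig (\<Lambda> n) \<beta> x))\<^sup>2 \<partial>\<mu>)"
      unfolding I_def using bdd by (rule cInf_lower)
    also have "\<dots> \<le> (1 - s\<^sup>2) * (I + \<eta>) + \<eta>"
    proof -
      have "(1 - s\<^sup>2) * (\<integral>x. (cmod (\<phi> x - trig F \<alpha> x))\<^sup>2 \<partial>\<mu>) \<le> (1 - s\<^sup>2) * (I + \<eta>)"
        using F(3) s_pos s_le by (intro mult_left_mono) (auto simp: power_le_one)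
      then show ?thesis using n(2) by linarith
    qed
    also have "\<dots> < I"
    proof -
      have "s\<^sup>2 * \<eta> > 0" using \<eta> s_pos by simp
      moreover have "(1 - s\<^sup>2) * (I + \<eta>) + \<eta> = I - 4 * \<eta> + 2 * \<eta> - s\<^sup>2 * \<eta>" 
      proof -
        have "s\<^sup>2 * I = 4 * \<eta>" unfolding \<eta>_def by simp
        then show ?thesis by (simp add: algebra_simps)
      qed
      ultimately show ?thesis using \<eta> by linarith
    qed
    finally show False by simp
  qed
  then have "Inf D < e" using e unfolding I_def by simp
  then obtain x where "x \<in> D" "x < e" using cInf_lessD[OF ne] by blast
  then show ?thesis using that unfolding D_def by blast
qed

lemma spectrum: "is_spectrum Spec \<mu>"
proof -
  interpret prob_space \<mu> by (rule \<mu>_prob)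
  have wave_sq: "square_integrable \<mu> (wave \<xi>)" for \<xi>
    unfolding square_integrable_def
    using continuous_borel_measurable[OF wave_continuous \<mu>_sets] by auto
  have "countable Spec"
    unfolding Spec_def using finite_Lambda_set by (intro countable_UN) (auto intro: countable_finite)
  moreover have "L2_inner \<mu> (wave \<xi>) (wave \<xi>') = (if \<xi> = \<xi>' then 1 else 0)" if \<xi>: "\<xi> \<in> Spec" "\<xi>' \<in> Spec" for \<xi> \<xi>'
  proof -
    \<comment> \<open>The sets \<open>\<Lambda> n\<close> increase because 0 is a frequency digit at
      every level, so two frequencies share a level.\<close>
    obtain m n where "\<xi> \<in> \<Lambda> m" "\<xi>' \<in> \<Lambda> n" using \<xi> unfolding Spec_def by blast
    then have "\<xi> \<in> \<Lambda> (max m n)" "\<xi>' \<in> \<Lambda> (max m n)"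
      using Lambda_set_mono[of m "max m n"] Lambda_set_mono[of n "max m n"] by auto
    then show ?thesis unfolding L2_inner_def by (rule integral_wave_product)
  qed
  moreover have "\<exists>F c. finite F \<and> F \<subseteq> Spec \<and> L2_norm \<mu> (\<lambda>x. f x - (\<Sum>\<xi>\<in>F. c \<xi> * wave \<xi> x)) < \<epsilon>"
    if f: "square_integrable \<mu> f" and \<epsilon>: "\<epsilon> > 0" for f \<epsilon>
  proof -
    \<comment> \<open>Two squared errors, each doubled by the splitting, have to stay below
      \<open>\<epsilon>\<^sup>2\<close> together.\<close>
    have e: "\<epsilon>\<^sup>2 / 4 > 0" using \<epsilon> by simp
    obtain \<phi> where \<phi>: "continuous_on UNIV \<phi>" "bounded (range \<phi>)" "(\<integral>x. (cmod (f x - \<phi> x))\<^sup>2 \<partial>\<mu>) < \<epsilon>\<^sup>2 / 4"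
      using L2_approx_square_integrable[OF prob_space.axioms(1)[OF \<mu>_prob] \<mu>_sets f] e unfolding L2_approx_def by blast
    obtain F \<alpha> where F: "finite F" "F \<subseteq> Spec" "(\<integral>x. (cmod (\<phi> x - trig F \<alpha> x))\<^sup>2 \<partial>\<mu>) < \<epsilon>\<^sup>2 / 4"
      using continuous_approx[OF \<phi>(1,2) e] by blast
    have i1: "integrable \<mu> (\<lambda>x. (cmod (f x - \<phi> x))\<^sup>2)"
      by (rule square_integrable_diff_bounded[OF finite_measure_axioms f continuous_borel_measurable[OF \<phi>(1) \<mu>_sets] \<phi>(2)])
    have i2: "integrable \<mu> (\<lambda>x. (cmod (\<phi> x - trig F \<alpha> x))\<^sup>2)"
      using \<phi> trig_continuous trig_bounded
      by (intro integrable_\<mu> bounded_range_sq bounded_range_diff) (auto intro!: continuous_intros)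
    have "(\<integral>x. (cmod (f x - trig F \<alpha> x))\<^sup>2 \<partial>\<mu>) \<le>
        (\<integral>x. 2 * (cmod (f x - \<phi> x))\<^sup>2 + 2 * (cmod (\<phi> x - trig F \<alpha> x))\<^sup>2 \<partial>\<mu>)"
    proof (rule integral_mono')
      show "(cmod (f x - trig F \<alpha> x))\<^sup>2 \<le> 2 * (cmod (f x - \<phi> x))\<^sup>2 + 2 * (cmod (\<phi> x - trig F \<alpha> x))\<^sup>2" for x
        using cmod_add_sq_le[of 1 "f x - \<phi> x" "\<phi> x - trig F \<alpha> x"] by simp
    qed (use i1 i2 in auto)
    also have "\<dots> = 2 * (\<integral>x. (cmod (f x - \<phi> x))\<^sup>2 \<partial>\<mu>) + 2 * (\<integral>x. (cmod (\<phi> x - trig F \<alpha> x))\<^sup>2 \<partial>\<mu>)"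
      using i1 i2 by simp
    also have "\<dots> < \<epsilon>\<^sup>2" using \<phi>(3) F(3) by linarith
    finally have "L2_norm \<mu> (\<lambda>x. f x - trig F \<alpha> x) < \<epsilon>"
      unfolding L2_norm_def using \<epsilon> by (intro real_less_lsqrt) auto
    then show ?thesis using F(1,2) unfolding trig_def by blast
  qed
  ultimately show ?thesis
    unfolding is_spectrum_def orthonormal_basis_def using wave_sq by blast
qed

end

section \<open>From the two spectral hypotheses to the lower bound\<close>

context compact_hadamard_sequence
begin

lemma spectrum_of_lower_bound:
  assumes "0 < s" and lower: "\<And>n c. n \<ge> 1 \<Longrightarrow> s * (\<Sum>b\<in>\<B> n. (cmod (c b))\<^sup>2) \<le>
      (\<Sum>\<xi>\<in>\<Lambda> n. (cmod (\<Sum>b\<in>\<B> n. F_matrix R B n \<xi> b * c b))\<^sup>2)"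
  shows "is_spectrum (\<Union>n\<in>{1..}. \<Lambda> n) \<mu>"
proof -
  \<comment> \<open>Capping at 1 only weakens the bound and keeps \<open>1 - s\<^sup>2\<close>
    nonnegative in the contraction.\<close>
  interpret lower_bound_sequence R B L \<mu> "min s 1"
  proof
    fix n :: nat and c :: "real ^ 'a \<Rightarrow> complex" assume n: "n \<ge> 1"
    have "min s 1 * (\<Sum>b\<in>\<B> n. (cmod (c b))\<^sup>2) \<le> s * (\<Sum>b\<in>\<B> n. (cmod (c b))\<^sup>2)"
      by (intro mult_right_mono sum_nonneg) auto
    also note lower[OF n]
    finally show "min s 1 * (\<Sum>b\<in>\<B> n. (cmod (c b))\<^sup>2) \<le>
      (\<Sum>\<xi>\<in>\<Lambda> n. (cmod (\<Sum>b\<in>\<B> n. F_matrix R B n \<xi> b * c b))\<^sup>2)" .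
  qed (use assms in auto)
  show ?thesis using spectrum unfolding Spec_def .
qed

lemma spectrum_of_singular_values:
  assumes "0 < (INF n\<in>{1..}. Min (\<sigma>_F R B L n))"
  shows "is_spectrum (\<Union>n\<in>{1..}. \<Lambda> n) \<mu>"
proof (rule spectrum_of_lower_bound[OF assms])
  fix n :: nat and c :: "real ^ 'a \<Rightarrow> complex" assume n: "n \<ge> 1"
  \<comment> \<open>The infimum is known to lie below its members only once the family is bounded
    below.\<close>
  have "0 \<le> Min (\<sigma>_F R B L n)" for n
    unfolding \<sigma>_F_def using finite_B_set B_set_zero by (intro Min_singular_values_nonneg) auto
  then have "bdd_below ((\<lambda>n. Min (\<sigma>_F R B L n)) ` {1..})" by (intro bdd_belowI2[where m=0])
  then have "(INF n\<in>{1..}. Min (\<sigma>_F R B L n)) \<le> Min (\<sigma>_F R B L n)"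
    using n by (intro cINF_lower) auto
  then have "(INF n\<in>{1..}. Min (\<sigma>_F R B L n)) * (\<Sum>b\<in>\<B> n. (cmod (c b))\<^sup>2) \<le>
      Min (\<sigma>_F R B L n) * (\<Sum>b\<in>\<B> n. (cmod (c b))\<^sup>2)"
    by (intro mult_right_mono sum_nonneg) auto
  also have "\<dots> \<le> (\<Sum>\<xi>\<in>\<Lambda> n. (cmod (\<Sum>b\<in>\<B> n. F_matrix R B n \<xi> b * c b))\<^sup>2)"
    unfolding \<sigma>_F_def by (rule Min_singular_values_le[OF finite_B_set])
  finally show "(INF n\<in>{1..}. Min (\<sigma>_F R B L n)) * (\<Sum>b\<in>\<B> n. (cmod (c b))\<^sup>2) \<le>
      (\<Sum>\<xi>\<in>\<Lambda> n. (cmod (\<Sum>b\<in>\<B> n. F_matrix R B n \<xi> b * c b))\<^sup>2)" .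
qed

text \<open>Stripped of the tail factors, \<open>F_matrix\<close> is unitary; expanding the squares
  leaves the column relations \<open>B_set_char_sum\<close>.\<close>

lemma parseval_B_set:
  "(\<Sum>\<xi>\<in>\<Lambda> n. (cmod (\<Sum>b\<in>\<B> n. c b * cnj (wave \<xi> b)))\<^sup>2) = real (M n) * (\<Sum>b\<in>\<B> n. (cmod (c b))\<^sup>2)"
proof -
  have "complex_of_real (\<Sum>\<xi>\<in>\<Lambda> n. (cmod (\<Sum>b\<in>\<B> n. c b * cnj (wave \<xi> b)))\<^sup>2) =
      (\<Sum>\<xi>\<in>\<Lambda> n. \<Sum>b\<in>\<B> n. \<Sum>b'\<in>\<B> n. cnj (c b) * c b' * wave \<xi> (b - b'))"
    unfolding complex_of_real_sum_cmod_sq cnj_sum sum_product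
    by (intro sum.cong refl) (simp add: cis_cnj inner_diff_right right_diff_distrib cis_divide[symmetric] divide_inverse mult_ac)
  also have "\<dots> = (\<Sum>b\<in>\<B> n. \<Sum>\<xi>\<in>\<Lambda> n. \<Sum>b'\<in>\<B> n. cnj (c b) * c b' * wave \<xi> (b - b'))"
    by (rule sum.swap)
  also have "\<dots> = (\<Sum>b\<in>\<B> n. \<Sum>b'\<in>\<B> n. \<Sum>\<xi>\<in>\<Lambda> n. cnj (c b) * c b' * wave \<xi> (b - b'))"
    by (intro sum.cong refl sum.swap)
  also have "\<dots> = (\<Sum>b\<in>\<B> n. \<Sum>b'\<in>\<B> n. cnj (c b) * c b' * (if b = b' then of_nat (M n) else 0))"
    by (intro sum.cong refl) (simp add: sum_distrib_left[symmetric] B_set_char_sum)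
  also have "\<dots> = (\<Sum>b\<in>\<B> n. cnj (c b) * c b * of_nat (M n))"
    using finite_B_set[of n] by (simp add: if_distrib cong: if_cong)
  also have "\<dots> = complex_of_real (real (M n) * (\<Sum>b\<in>\<B> n. (cmod (c b))\<^sup>2))"
    unfolding of_real_mult complex_of_real_sum_cmod_sq by (simp add: sum_distrib_left mult_ac)
  finally show ?thesis unfolding of_real_eq_iff .
qed

text \<open>\<open>F_matrix\<close> is a unitary matrix whose rows are scaled by the moduli of the
  tail transform. Factors of at least ?s preserve at least the fraction \<open>?s\<^sup>2\<close> of
  the squared norm, whence the square.\<close>

lemma spectrum_of_fourier_bound:
  assumes "0 < (INF n\<in>{1..}. INF \<xi>\<in>\<Lambda> n. cmod (fourier (\<tau> n) \<xi>))" (is "0 < ?s")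
  shows "is_spectrum (\<Union>n\<in>{1..}. \<Lambda> n) \<mu>"
proof (rule spectrum_of_lower_bound)
  show "0 < ?s\<^sup>2" using assms by simp
  fix n :: nat and c :: "real ^ 'a \<Rightarrow> complex" assume n: "n \<ge> 1"
  have ne: "\<Lambda> n \<noteq> {}" for n using card_Lambda_set[of n] M_pos[of n] by auto
  have "0 \<le> (INF \<xi>\<in>\<Lambda> n. cmod (fourier (\<tau> n) \<xi>))" for n
    using ne by (intro cINF_greatest) auto
  then have "bdd_below ((\<lambda>n. INF \<xi>\<in>\<Lambda> n. cmod (fourier (\<tau> n) \<xi>)) ` {1..})" by (intro bdd_belowI2[where m=0])
  then have "?s \<le> (INF \<xi>\<in>\<Lambda> n. cmod (fourier (\<tau> n) \<xi>))" using n by (intro cINF_lower) auto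
  also have "\<dots> \<le> cmod (fourier (\<tau> n) \<xi>)" if "\<xi> \<in> \<Lambda> n" for \<xi>
    using that by (intro cINF_lower bdd_belowI2[where m=0]) auto
  finally have "?s\<^sup>2 \<le> (cmod (fourier (\<tau> n) \<xi>))\<^sup>2" if "\<xi> \<in> \<Lambda> n" for \<xi>
    using that assms by (intro power_mono) auto
  then have "(\<Sum>\<xi>\<in>\<Lambda> n. ?s\<^sup>2 * ((cmod (\<Sum>b\<in>\<B> n. c b * cnj (wave \<xi> b)))\<^sup>2 / real (M n))) \<le>
      (\<Sum>\<xi>\<in>\<Lambda> n. (cmod (fourier (\<tau> n) \<xi>))\<^sup>2 * ((cmod (\<Sum>b\<in>\<B> n. c b * cnj (wave \<xi> b)))\<^sup>2 / real (M n)))"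
    by (intro sum_mono mult_right_mono) auto
  also have "\<dots> = (\<Sum>\<xi>\<in>\<Lambda> n. (cmod (\<Sum>b\<in>\<B> n. F_matrix R B n \<xi> b * c b))\<^sup>2)"
    unfolding cmod_F_matrix_sum by (simp add: mult_ac)
  also have "(\<Sum>\<xi>\<in>\<Lambda> n. ?s\<^sup>2 * ((cmod (\<Sum>b\<in>\<B> n. c b * cnj (wave \<xi> b)))\<^sup>2 / real (M n))) =
      ?s\<^sup>2 * (\<Sum>b\<in>\<B> n. (cmod (c b))\<^sup>2)"
    unfolding sum_distrib_left[symmetric] sum_divide_distrib[symmetric] parseval_B_set using M_pos[of n] by simp
  finally show "?s\<^sup>2 * (\<Sum>b\<in>\<B> n. (cmod (c b))\<^sup>2) \<le>
      (\<Sum>\<xi>\<in>\<Lambda> n. (cmod (\<Sum>b\<in>\<B> n. F_matrix R B n \<xi> b * c b))\<^sup>2)" .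
qed

end

theorem theorem1p2:
  fixes R :: "nat \<Rightarrow> real ^ 'd ^ 'd"
    and B L :: "nat \<Rightarrow> (real ^ 'd) set"
    and \<mu> :: "(real ^ 'd) measure"
  assumes "\<And>i. i \<ge> 1 \<Longrightarrow> hadamard_triple (R i) (B i) (L i)"
    and "is_infinite_convolution (\<lambda>k. factor R B (Suc k)) \<mu>"
    and "no_overlap R B \<mu>"
    and "compact (measure_support \<mu>)"
  shows "(0 < (INF n\<in>{1..}. Min (\<sigma>_F R B L n)) \<longrightarrow>
            is_spectrum (\<Union>n\<in>{1..}. Lambda_set R L n) \<mu>) \<and>
         (0 < (INF n\<in>{1..}. INF \<xi>\<in>Lambda_set R L n. cmod (fourier (tail_measure R B n) \<xi>)) \<longrightarrow>
            is_spectrum (\<Union>n\<in>{1..}. Lambda_set R L n) \<mu>)"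
proof -
  interpret compact_hadamard_sequence R B L \<mu>
    using assms(1,2,4) by unfold_locales
  show ?thesis using spectrum_of_singular_values spectrum_of_fourier_bound by blast
qed

end
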